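(* Let $n\geqslant 2$ and let $(x_i)_{i\in\mathbb{Z}}$ be a sequence of points on the unit sphere $\Sigma^n\subseteq\mathbb{R}^{n+1}$. If $$\sup_{\ell\in\mathbb{Z}}\operatorname{dist}(x_\ell,x_{\ell+1})<0.4,$$ then the Riemannian analogue $T$ on $\Sigma^n$ of the linear subdivision scheme $$(Sx)_{2i}=-\tfrac1{32}x_{i-1}+\tfrac{21}{32}x_i+\tfrac{13}{32}x_{i+1}-\tfrac1{32}x_{i+2},$$ $$(Sx)_{2i+1}=-\tfrac1{32}x_{i-1}+\tfrac{13}{32}x_i+\tfrac{21}{32}x_{i+1}-\tfrac1{32}x_{i+2}\qquad(i\in\mathbb{Z})$$ converges, for the input data $(x_i)_{i\in\mathbb{Z}}$, to a continuous limit function on the unit sphere.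
   Context: $\Sigma^n$ carries its standard Riemannian metric, with distance $\operatorname{dist}(p,q)=\arccos\langle p,q\rangle$. $B_\rho(p)=\{y\in\Sigma^n\mid \operatorname{dist}(p,y)<\rho\}$. Riemannian analogue: for a linear binary subdivision rule given by affine combinations $(Sx)_i=\sum_{j\in\mathbb{Z}}c_{i,j}x_j$ (finitely many nonzero real coefficients $c_{i,j}=a_{i-2j}$ for each $i$, with $\sum_j c_{i,j}=1$), its Riemannian analogue $T$ is $$Tx_i=\operatorname{arg\,min}_{x\in\Sigma^n}\sum_{j\in\mathbb{Z}}c_{i,j}\operatorname{dist}(x,x_j)^2 .$$ The minimiser is understood locally. If the points $x_j$ contributing to $Tx_i$ (those with $c_{i,j}\neq0$) lie in a ball $B_\rho(p)$ and, with $\alpha_-$ denoting the sum of the absolute values of the negative coefficients among the $c_{i,j}$, there is $\rho^*>\rho$ with $(1+2\alpha_-)\rho<\rho^*<\frac{\pi}{4}\left(1+(1+\frac{\pi}{2})\alpha_-\right)^{-1}$, then the function being minimised has a unique minimiser in $B_{\rho^*}(p)$ (a known result), and $Tx_i$ is that minimiser. Convergence: $T$ converges for input data $x$ if the iterates $x,Tx,T^2x,\dots$ are defined and the functions $f_k$ with $f_k\left(\frac{i}{2^k}\right)=T^kx_i$ for all $i\in\mathbb{Z}$, obtained by piecewise linear interpolation in coordinate charts, converge as $k\to\infty$, uniformly on compact sets, to a continuous limit function $\mathbb{R}\to\Sigma^n$. *)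

theory Defs
  imports "HOL-Analysis.Analysis"
begin

section \<open>The unit sphere as a Riemannian manifold\<close>

definition sdist :: "'a::euclidean_space \<Rightarrow> 'a \<Rightarrow> real" where
  "sdist p q = arccos (p \<bullet> q)"

definition sball :: "real \<Rightarrow> 'a::euclidean_space \<Rightarrow> 'a set" where
  "sball \<rho> p = {y \<in> sphere 0 1. sdist p y < \<rho>}"

text \<open>At \<open>v = 0\<close> the convention \<open>x / 0 = 0\<close> gives the correct value \<open>p\<close>.\<close>

definition sphere_exp :: "'a::euclidean_space \<Rightarrow> 'a \<Rightarrow> 'a" where
  "sphere_exp p v = cos (norm v) *\<^sub>R p + (sin (norm v) / norm v) *\<^sub>R v"

text \<open>The exponential map is injective on the open ball of radius \<open>pi\<close> in the tangent space
  \<open>{v. p \<bullet> v = 0}\<close>, with image the sphere minus the antipode \<open>- p\<close>.\<close>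

definition normal_coords :: "'a::euclidean_space \<Rightarrow> 'a \<Rightarrow> 'a" where
  "normal_coords p = inv_into {v. p \<bullet> v = 0 \<and> norm v < pi} (sphere_exp p)"

section \<open>Linear binary subdivision rules\<close>

text \<open>A rule is given by its finitely supported mask \<open>a\<close>; the coefficients are
  \<open>c i j = a (i - 2 * j)\<close>.\<close>

definition stencil :: "(int \<Rightarrow> real) \<Rightarrow> int \<Rightarrow> int set" where
  "stencil a i = {j. a (i - 2 * j) \<noteq> 0}"

definition linear_subdivision ::
    "(int \<Rightarrow> real) \<Rightarrow> (int \<Rightarrow> 'a::real_vector) \<Rightarrow> int \<Rightarrow> 'a" where
  "linear_subdivision a x i = (\<Sum>j\<in>stencil a i. a (i - 2 * j) *\<^sub>R x j)"

definition negative_mass :: "(int \<Rightarrow> real) \<Rightarrow> int \<Rightarrow> real" where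
  "negative_mass a i = (\<Sum>j | a (i - 2 * j) < 0. \<bar>a (i - 2 * j)\<bar>)"

section \<open>The Riemannian analogue of a linear rule\<close>

definition squared_dist_sum ::
    "(int \<Rightarrow> real) \<Rightarrow> (int \<Rightarrow> 'a::euclidean_space) \<Rightarrow> int \<Rightarrow> 'a \<Rightarrow> real" where
  "squared_dist_sum a x i y = (\<Sum>j\<in>stencil a i. a (i - 2 * j) * (sdist y (x j))\<^sup>2)"

definition admissible_balls ::
    "(int \<Rightarrow> real) \<Rightarrow> (int \<Rightarrow> 'a::euclidean_space) \<Rightarrow> int \<Rightarrow> 'a \<Rightarrow> real \<Rightarrow> real \<Rightarrow> bool" where
  "admissible_balls a x i p \<rho> \<rho>' \<longleftrightarrow>
     p \<in> sphere 0 1 \<and> (\<forall>j\<in>stencil a i. x j \<in> sball \<rho> p) \<and> \<rho> < \<rho>' \<and>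
     (1 + 2 * negative_mass a i) * \<rho> < \<rho>' \<and>
     \<rho>' < pi / 4 * inverse (1 + (1 + pi / 2) * negative_mass a i)"

definition unique_minimiser_on :: "('a \<Rightarrow> real) \<Rightarrow> 'a set \<Rightarrow> 'a \<Rightarrow> bool" where
  "unique_minimiser_on f B y \<longleftrightarrow> y \<in> B \<and> (\<forall>z\<in>B. z \<noteq> y \<longrightarrow> f y < f z)"

text \<open>The new point is defined if the contributing points admit some pair of concentric balls as
  above; it has to be the minimiser for every such pair, so the choice of balls is irrelevant.\<close>

definition is_riemannian_value ::
    "(int \<Rightarrow> real) \<Rightarrow> (int \<Rightarrow> 'a::euclidean_space) \<Rightarrow> int \<Rightarrow> 'a \<Rightarrow> bool" where
  "is_riemannian_value a x i y \<longleftrightarrow>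
     (\<exists>p \<rho> \<rho>'. admissible_balls a x i p \<rho> \<rho>') \<and>
     (\<forall>p \<rho> \<rho>'. admissible_balls a x i p \<rho> \<rho>' \<longrightarrow>
        unique_minimiser_on (squared_dist_sum a x i) (sball \<rho>' p) y)"

lemma is_riemannian_value_unique:
  "is_riemannian_value a x i y \<Longrightarrow> is_riemannian_value a x i z \<Longrightarrow> y = z"
  unfolding is_riemannian_value_def unique_minimiser_on_def by (metis less_asym)

definition riemannian_analogue ::
    "(int \<Rightarrow> real) \<Rightarrow> (int \<Rightarrow> 'a::euclidean_space) \<Rightarrow> int \<Rightarrow> 'a" where
  "riemannian_analogue a x i = (THE y. is_riemannian_value a x i y)"

definition riemannian_analogue_defined ::
    "(int \<Rightarrow> real) \<Rightarrow> (int \<Rightarrow> 'a::euclidean_space) \<Rightarrow> bool" where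
  "riemannian_analogue_defined a x \<longleftrightarrow> (\<forall>i. \<exists>y. is_riemannian_value a x i y)"

section \<open>Convergence\<close>

text \<open>Piecewise linear interpolation of the data \<open>y i\<close> at the parameters \<open>i / 2 ^ k\<close>; on
  \<open>[i / 2 ^ k, (i + 1) / 2 ^ k]\<close> it is linear in the normal coordinate chart centred at \<open>y i\<close>.
  The values for antipodal neighbours, where this chart does not apply, are irrelevant: if such
  neighbours occur on a compact parameter set for infinitely many \<open>k\<close>, the values at the grid
  points already exclude uniform convergence to a continuous function.\<close>

definition chart_interpolation ::
    "nat \<Rightarrow> (int \<Rightarrow> 'a::euclidean_space) \<Rightarrow> real \<Rightarrow> 'a" where
  "chart_interpolation k y t =
     (let i = \<lfloor>2 ^ k * t\<rfloor>; s = 2 ^ k * t - of_int i in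
      sphere_exp (y i) ((1 - s) *\<^sub>R normal_coords (y i) (y i)
                        + s *\<^sub>R normal_coords (y i) (y (i + 1))))"

text \<open>Uniform convergence is taken in the ambient norm, which on the sphere is uniformly equivalent
  to \<^const>\<open>sdist\<close>.\<close>

definition riemannian_converges ::
    "(int \<Rightarrow> real) \<Rightarrow> (int \<Rightarrow> 'a::euclidean_space) \<Rightarrow> bool" where
  "riemannian_converges a x \<longleftrightarrow>
     (\<forall>k. riemannian_analogue_defined a ((riemannian_analogue a ^^ k) x)) \<and>
     (\<exists>f. continuous_on UNIV f \<and> (\<forall>t. f t \<in> sphere 0 1) \<and>
        (\<forall>C. compact C \<longrightarrow>
           uniform_limit C (\<lambda>k. chart_interpolation k ((riemannian_analogue a ^^ k) x))
             f sequentially))"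

lemma sphere_exp_inj:
  assumes "p \<in> sphere 0 1"
  shows "inj_on (sphere_exp p) {v. p \<bullet> v = 0 \<and> norm v < pi}"
proof (rule inj_onI)
  fix v w
  assume v: "v \<in> {v. p \<bullet> v = 0 \<and> norm v < pi}" and w: "w \<in> {v. p \<bullet> v = 0 \<and> norm v < pi}"
    and eq: "sphere_exp p v = sphere_exp p w"
  have pp: "p \<bullet> p = 1" using assms by (simp add: norm_eq_1)
  have "p \<bullet> sphere_exp p v = cos (norm v)" "p \<bullet> sphere_exp p w = cos (norm w)"
    using v w pp by (auto simp: sphere_exp_def inner_add_right)
  then have n: "norm v = norm w"
    using eq v w cos_inj_pi[of "norm v" "norm w"] by auto
  show "v = w"
  proof (cases "v = 0")
    case True
    then show ?thesis using n by simp
  next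
    case False
    then have "sin (norm v) > 0" using v by (intro sin_gt_zero) auto
    then show ?thesis using eq n False by (auto simp: sphere_exp_def)
  qed
qed

lemma normal_coords_exp:
  assumes "p \<in> sphere 0 1" "p \<bullet> v = 0" "norm v < pi"
  shows "normal_coords p (sphere_exp p v) = v"
  unfolding normal_coords_def using assms by (intro inv_into_f_f sphere_exp_inj) auto

lemma exp_normal_coords:
  assumes p: "p \<in> sphere 0 1" and q: "q \<in> sphere 0 1" and "q \<noteq> - p"
  shows "sphere_exp p (normal_coords p q) = q"
proof -
  define d where "d = sdist p q"
  define u where "u = q - (p \<bullet> q) *\<^sub>R p"
  have pp: "p \<bullet> p = 1" and qq: "q \<bullet> q = 1" using p q by (simp_all add: norm_eq_1)
  have le: "\<bar>p \<bullet> q\<bar> \<le> 1" using Cauchy_Schwarz_ineq2[of p q] p q by simp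
  have c: "cos d = p \<bullet> q" using le by (simp add: d_def sdist_def cos_arccos_abs)
  have d0: "0 \<le> d" "d \<le> pi"
    using le by (auto simp: d_def sdist_def intro: arccos_lbound arccos_ubound)
  have "p \<bullet> q \<noteq> - 1"
  proof
    assume "p \<bullet> q = - 1"
    then have "(q + p) \<bullet> (q + p) = 0" using pp qq by (simp add: inner_add inner_commute)
    then show False using \<open>q \<noteq> - p\<close> by (simp add: eq_neg_iff_add_eq_0)
  qed
  then have dpi: "d < pi" using c d0 by (metis cos_pi less_eq_real_def)
  have "u \<bullet> u = 1 - (p \<bullet> q)\<^sup>2"
    unfolding u_def using pp qq by (simp add: inner_diff inner_commute power2_eq_square)
  also have "\<dots> = (sin d)\<^sup>2" using c by (simp add: sin_squared_eq)
  finally have nu: "norm u = sin d"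
    using d0 by (simp add: norm_eq_sqrt_inner sin_ge_zero)
  have up: "p \<bullet> u = 0" by (simp add: u_def inner_diff pp)
  have "q \<in> sphere_exp p ` {v. p \<bullet> v = 0 \<and> norm v < pi}"
  proof (cases "d = 0")
    case True
    then have "u = 0" using nu by simp
    then have "q = p" using True c by (simp add: u_def)
    then show ?thesis by (intro image_eqI[of _ _ 0]) (auto simp: sphere_exp_def)
  next
    case False
    then have s: "sin d > 0" using d0 dpi by (intro sin_gt_zero) auto
    let ?v = "(d / sin d) *\<^sub>R u"
    have nv: "norm ?v = d" using s d0 nu by simp
    have "sphere_exp p ?v = q"
      unfolding sphere_exp_def nv using s False c by (simp add: u_def)
    then show ?thesis using nv dpi up by (intro image_eqI[of _ _ ?v]) auto
  qed
  then show ?thesis unfolding normal_coords_def by (rule f_inv_into_f)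
qed

lemma chart_interpolation_grid:
  assumes "y i \<in> sphere 0 1"
  shows "chart_interpolation k y (of_int i / 2 ^ k) = y i"
proof -
  have "normal_coords (y i) (y i) = 0"
    using normal_coords_exp[OF assms, of 0] by (simp add: sphere_exp_def)
  then show ?thesis by (simp add: chart_interpolation_def sphere_exp_def)
qed

section \<open>The four-point scheme under consideration\<close>

definition scheme_mask :: "int \<Rightarrow> real" where
  "scheme_mask m =
     (if m \<in> {-4, -3, 2, 3} then - 1 / 32
      else if m \<in> {-2, 1} then 13 / 32
      else if m \<in> {-1, 0} then 21 / 32
      else 0)"

lemma stencil_scheme:
  "stencil scheme_mask (2 * i) = {i - 1, i, i + 1, i + 2}"
  "stencil scheme_mask (2 * i + 1) = {i - 1, i, i + 1, i + 2}"
  by (auto simp: stencil_def scheme_mask_def split: if_splits; presburger)+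

lemma scheme_even:
  "linear_subdivision scheme_mask x (2 * i) =
     (- 1 / 32) *\<^sub>R x (i - 1) + (21 / 32) *\<^sub>R x i + (13 / 32) *\<^sub>R x (i + 1)
     + (- 1 / 32) *\<^sub>R x (i + 2)"
  unfolding linear_subdivision_def stencil_scheme by (simp add: scheme_mask_def)

lemma scheme_odd:
  "linear_subdivision scheme_mask x (2 * i + 1) =
     (- 1 / 32) *\<^sub>R x (i - 1) + (13 / 32) *\<^sub>R x i + (21 / 32) *\<^sub>R x (i + 1)
     + (- 1 / 32) *\<^sub>R x (i + 2)"
  unfolding linear_subdivision_def stencil_scheme by (simp add: scheme_mask_def)

end

theory Submission
  imports Defs
begin

text \<open>
  The scheme contracts: there is a factor \<open>q < 1\<close> such that a refinement step multiplies the largest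
  distance \<open>\<delta>\<close> between neighbouring data points by at most \<open>q\<close>, while the new point with an even
  index stays within distance \<open>\<delta>\<close> of the old point that it replaces. Hence the iterates are defined,
  and consecutive interpolating functions differ by at most a multiple of \<open>q ^ k\<close>. They form a uniform
  Cauchy sequence, and the limit is continuous since the oscillation of the interpolating functions
  on parameter intervals of length \<open>2\<^sup>-\<^sup>k\<close> tends to zero (\<open>scheme_converges\<close>).

  A new point minimises a sum \<open>E\<close> of squared distances to four consecutive data points with weights
  \<open>- 1, 21, 13, - 1\<close> over \<open>32\<close>. Its negative half gradient, the force, is the corresponding sum of the
  vectors \<open>log\<^sub>y x\<close>, where \<open>log\<^sub>y\<close> is the inverse of the exponential map at \<open>y\<close>. Two facts on the
  geometry of the sphere control it.

  \<^item> Along a unit speed geodesic the second derivative of half the squared distance \<open>\<theta>\<close> to a point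
    lies between \<open>\<theta> cot \<theta>\<close> and one (\<open>half_square_sdist_derivatives\<close>). For data with
    \<open>\<delta> \<le> 0.4\<close>, half the second derivative of \<open>E\<close> therefore is at least \<open>0.9337\<close> near the new point.
    It follows that the distance of a point \<open>y\<close> from the zero of the force is at most the norm of the
    force at \<open>y\<close>, divided by this number (\<open>scheme_force_stability\<close>).
  \<^item> The map \<open>log\<^sub>y\<close> is Lipschitz with constant \<open>R / sin R\<close> on the ball of radius \<open>R\<close>
    around \<open>y\<close> (\<open>sphere_log_lipschitz\<close>).

  Now let \<open>y\<close> and \<open>z\<close> be neighbouring new points. The force that defines \<open>z\<close>, evaluated at \<open>y\<close>, equals
  its difference to the vanishing force that defines \<open>y\<close>, and this is a combination of differences
  \<open>log\<^sub>y x\<^sub>j\<^sub>+\<^sub>1 - log\<^sub>y x\<^sub>j\<close> with the coefficients of the linear rule for differences, of absolute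
  sum at most \<open>7 / 8\<close>. With the Lipschitz constants of the logarithm the norm of the force is at most
  \<open>0.9197 \<delta>\<close>, so that stability gives contraction with \<open>q = 0.99\<close>
  (\<open>contraction_adjacent_edges\<close>, \<open>contraction_same_edge\<close>).

  The new points have to be identified with zeros of the force. On a small ball around the data point
  of largest weight, \<open>E\<close> has a minimum in the interior, and there the force vanishes
  (\<open>scheme_force_zero_exists\<close>). This zero belongs to every admissible
  ball, because at a point too far from the centre the force has a component towards the centre
  (\<open>scheme_force_zero_in_ball\<close>), and it is the only minimiser there, because \<open>E\<close> is strictly
  convex on the ball (\<open>scheme_force_zero_minimises\<close>).
\<close>

section \<open>Spherical distance\<close>

lemma inner_unit_bounds:
  fixes p q :: "'a::euclidean_space"
  assumes "norm p = 1" "norm q = 1"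
  shows "- 1 \<le> p \<bullet> q" "p \<bullet> q \<le> 1"
  using Cauchy_Schwarz_ineq2[of p q] assms by (simp_all add: abs_le_iff)

lemma sdist_commute: "sdist p q = sdist q p"
  by (simp add: sdist_def inner_commute)

lemma cos_sdist: "norm p = 1 \<Longrightarrow> norm q = 1 \<Longrightarrow> cos (sdist p q) = p \<bullet> q"
  using inner_unit_bounds[of p q] by (simp add: sdist_def)

lemma sdist_nonneg: "norm p = 1 \<Longrightarrow> norm q = 1 \<Longrightarrow> 0 \<le> sdist p q"
  and sdist_le_pi: "norm p = 1 \<Longrightarrow> norm q = 1 \<Longrightarrow> sdist p q \<le> pi"
  using inner_unit_bounds[of p q] by (simp_all add: sdist_def arccos_lbound arccos_ubound)

lemma sin_sdist:
  assumes "norm p = 1" "norm q = 1"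
  shows "sin (sdist p q) = sqrt (1 - (p \<bullet> q)\<^sup>2)"
  using inner_unit_bounds[OF assms] by (simp add: sdist_def sin_arccos)

lemma sdist_eqI: "p \<bullet> q = cos t \<Longrightarrow> 0 \<le> t \<Longrightarrow> t \<le> pi \<Longrightarrow> sdist p q = t"
  by (simp add: sdist_def arccos_cos)

lemma sdist_le_iff:
  assumes "norm p = 1" "norm q = 1" "0 \<le> r" "r \<le> pi"
  shows "sdist p q \<le> r \<longleftrightarrow> cos r \<le> p \<bullet> q"
  using cos_mono_le_eq[of r "sdist p q"] assms
  by (simp add: cos_sdist sdist_nonneg sdist_le_pi)

lemma sdist_self: "norm p = 1 \<Longrightarrow> sdist p p = 0"
  by (simp add: sdist_def norm_eq_1)

lemma sdist_eq_0_iff: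
  assumes "norm p = 1" "norm q = 1"
  shows "sdist p q = 0 \<longleftrightarrow> p = q"
proof
  assume "sdist p q = 0"
  then have "p \<bullet> q = 1" using cos_sdist[OF assms] by simp
  then have "(p - q) \<bullet> (p - q) = 0"
    using assms by (simp add: inner_diff inner_commute norm_eq_1)
  then show "p = q" by simp
qed (simp add: sdist_self assms)

lemma norm_diff_le_sdist:
  assumes "norm p = 1" "norm q = 1"
  shows "norm (p - q) \<le> sdist p q"
proof (rule power2_le_imp_le)
  let ?d = "sdist p q"
  have "(norm (p - q))\<^sup>2 = 2 - 2 * (p \<bullet> q)"
    unfolding power2_norm_eq_inner using assms
    by (simp add: inner_diff inner_commute norm_eq_1)
  also have "\<dots> = 2 - 2 * cos (2 * (?d / 2))" using cos_sdist[OF assms] by simp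
  also have "\<dots> = 4 * (sin (?d / 2))\<^sup>2" unfolding cos_double_sin by simp
  also have "\<dots> \<le> 4 * (?d / 2)\<^sup>2"
    using abs_sin_x_le_abs_x[of "?d / 2"] by (simp only: abs_le_square_iff)
  finally show "(norm (p - q))\<^sup>2 \<le> ?d\<^sup>2" by (simp add: power2_eq_square)
qed (simp add: sdist_nonneg assms)

text \<open>The components of two unit vectors orthogonal to a third one have lengths equal to the sines
  of the distances; Cauchy-Schwarz for these components is the triangle inequality.\<close>

lemma sdist_triangle:
  assumes p: "norm p = 1" and q: "norm q = 1" and r: "norm r = 1"
  shows "sdist p r \<le> sdist p q + sdist q r"
proof (cases "sdist p q + sdist q r \<le> pi")
  case True
  let ?a = "sdist p q" and ?b = "sdist q r"
  have *: "norm (p - (p \<bullet> q) *\<^sub>R q) = sin (sdist p q)"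
    if "norm p = 1" for p :: 'a
  proof -
    have "(norm (p - (p \<bullet> q) *\<^sub>R q))\<^sup>2 = 1 - (p \<bullet> q)\<^sup>2"
      unfolding power2_norm_eq_inner using that q
      by (simp add: inner_diff inner_commute norm_eq_1 power2_eq_square)
    then show ?thesis using sin_sdist[OF that q] by (metis norm_ge_zero real_sqrt_unique)
  qed
  have "- ((p - (p \<bullet> q) *\<^sub>R q) \<bullet> (r - (r \<bullet> q) *\<^sub>R q)) \<le> sin ?a * sin ?b"
    using norm_cauchy_schwarz[of "- (p - (p \<bullet> q) *\<^sub>R q)" "r - (r \<bullet> q) *\<^sub>R q"] *[OF p] *[OF r]
    by (simp only: inner_minus_left norm_minus_cancel sdist_commute[of r q])
  moreover have "(p - (p \<bullet> q) *\<^sub>R q) \<bullet> (r - (r \<bullet> q) *\<^sub>R q) = p \<bullet> r - (p \<bullet> q) * (q \<bullet> r)"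
    using q by (simp add: inner_diff inner_commute norm_eq_1)
  ultimately have "cos (?a + ?b) \<le> p \<bullet> r"
    using cos_sdist[OF p q] cos_sdist[OF q r] by (simp add: cos_add)
  then show ?thesis
    using sdist_le_iff[OF p r _ True] sdist_nonneg[OF p q] sdist_nonneg[OF q r] by simp
next
  case False
  then show ?thesis using sdist_le_pi[OF p r] by simp
qed

lemma continuous_on_sdist:
  assumes "norm x = 1"
  shows "continuous_on (sphere 0 1) (\<lambda>y. sdist y x)"
  unfolding sdist_def
  by (rule continuous_on_arccos) (auto intro!: continuous_intros simp: assms inner_unit_bounds)

section \<open>Geodesics\<close>

text \<open>For orthonormal \<open>p\<close> and \<open>u\<close> this is the unit speed geodesic that starts at \<open>p\<close> with
  velocity \<open>u\<close>; its velocity is \<^term>\<open>geodesic u (- p)\<close>.\<close>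

definition geodesic :: "'a::euclidean_space \<Rightarrow> 'a \<Rightarrow> real \<Rightarrow> 'a" where
  "geodesic p u t = cos t *\<^sub>R p + sin t *\<^sub>R u"

definition tangent_direction :: "'a::euclidean_space \<Rightarrow> 'a \<Rightarrow> bool" where
  "tangent_direction p u \<longleftrightarrow> norm p = 1 \<and> norm u = 1 \<and> p \<bullet> u = 0"

lemma norm_geodesic:
  assumes "tangent_direction p u"
  shows "norm (geodesic p u t) = 1"
proof -
  have "geodesic p u t \<bullet> geodesic p u t = (cos t)\<^sup>2 + (sin t)\<^sup>2"
    using assms unfolding geodesic_def tangent_direction_def norm_eq_1
    by (simp add: inner_add inner_commute power2_eq_square)
  then show ?thesis by (simp add: norm_eq_1)
qed

lemma norm_velocity:
  assumes "tangent_direction p u"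
  shows "norm (geodesic u (- p) t) = 1"
  using assms by (intro norm_geodesic) (simp add: tangent_direction_def inner_commute)

lemma inner_geodesic_velocity:
  assumes "tangent_direction p u"
  shows "geodesic p u t \<bullet> geodesic u (- p) t = 0"
  using assms unfolding geodesic_def tangent_direction_def norm_eq_1
  by (simp add: inner_add inner_diff inner_commute)

lemma geodesic_0 [simp]: "geodesic p u 0 = p"
  by (simp add: geodesic_def)

lemma inner_start_geodesic:
  assumes "tangent_direction p u"
  shows "p \<bullet> geodesic p u t = cos t"
  using assms by (simp add: geodesic_def tangent_direction_def inner_add norm_eq_1)

lemma sdist_start_geodesic:
  assumes "tangent_direction p u" "0 \<le> t" "t \<le> pi"
  shows "sdist p (geodesic p u t) = t"
  using inner_start_geodesic assms by (intro sdist_eqI) auto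

lemma geodesic_between:
  assumes p: "norm p = 1" and q: "norm q = 1" and "sdist p q = L" "0 < L" "L < pi"
  obtains u where "tangent_direction p u" "geodesic p u L = q"
proof
  let ?d = "sdist p q"
  let ?u = "(1 / sin ?d) *\<^sub>R (q - (p \<bullet> q) *\<^sub>R p)"
  have s: "sin ?d > 0" using assms by (intro sin_gt_zero) auto
  have "(norm (q - (p \<bullet> q) *\<^sub>R p))\<^sup>2 = 1 - (p \<bullet> q)\<^sup>2"
    unfolding power2_norm_eq_inner using p q
    by (simp add: inner_diff inner_commute norm_eq_1 power2_eq_square)
  then have "norm (q - (p \<bullet> q) *\<^sub>R p) = sin ?d"
    using sin_sdist[OF p q] by (metis norm_ge_zero real_sqrt_unique)
  then show "tangent_direction p ?u"
    using p s by (simp add: tangent_direction_def inner_diff norm_eq_1)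
  show "geodesic p ?u L = q"
    using s cos_sdist[OF p q] assms(3) by (simp add: geodesic_def)
qed

text \<open>A point of a geodesic segment is a combination of the endpoints with nonnegative weights of
  sum at least one, so spherical balls of radius at most a quarter circle are convex.\<close>

lemma inner_geodesic_ge:
  assumes L: "0 < L" "L < pi" and t: "0 \<le> t" "t \<le> L" and "0 \<le> C"
    and "C \<le> x \<bullet> p" "C \<le> x \<bullet> geodesic p u L"
  shows "C \<le> x \<bullet> geodesic p u t"
proof -
  have s: "sin L > 0" using L by (intro sin_gt_zero)
  have n: "0 \<le> sin (L - t)" "0 \<le> sin t" using L t by (auto intro!: sin_ge_zero)
  have "sin L = sin (L - t) * cos t + cos (L - t) * sin t"
    using sin_add[of "L - t" t] by simp
  also have "\<dots> \<le> sin (L - t) * 1 + 1 * sin t"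
    using n by (intro add_mono mult_left_mono mult_right_mono) auto
  finally have "C * sin L \<le> sin (L - t) * C + sin t * C"
    using mult_left_mono[of "sin L" "sin (L - t) + sin t" C] \<open>0 \<le> C\<close> by (simp add: algebra_simps)
  also have "\<dots> \<le> sin (L - t) * (x \<bullet> p) + sin t * (x \<bullet> geodesic p u L)"
    using n assms by (intro add_mono mult_left_mono) auto
  also have "\<dots> = sin L * (x \<bullet> geodesic p u t)"
    by (simp add: geodesic_def inner_add sin_diff algebra_simps)
  finally show ?thesis using s by (simp add: mult.commute)
qed

lemma sdist_geodesic_le:
  assumes "tangent_direction p u" "norm x = 1" "0 < L" "L < pi" "0 \<le> t" "t \<le> L"
    and "0 \<le> R" "R \<le> pi / 2" "sdist x p \<le> R" "sdist x (geodesic p u L) \<le> R"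
  shows "sdist x (geodesic p u t) \<le> R"
proof -
  have n: "norm p = 1" "norm (geodesic p u s) = 1" for s
    using assms(1) norm_geodesic by (auto simp: tangent_direction_def)
  have "cos R \<ge> 0" using assms by (intro cos_ge_zero) auto
  then show ?thesis
    using inner_geodesic_ge[OF assms(3-6), of "cos R" x p u] assms sdist_le_iff[of x _ R] n by auto
qed

section \<open>The inverse exponential map\<close>

definition arc_ratio :: "real \<Rightarrow> real" where
  "arc_ratio \<theta> = (if \<theta> = 0 then 1 else \<theta> / sin \<theta>)"

definition sphere_log :: "'a::euclidean_space \<Rightarrow> 'a \<Rightarrow> 'a" where
  "sphere_log p q = arc_ratio (sdist p q) *\<^sub>R (q - (p \<bullet> q) *\<^sub>R p)"

lemma arc_ratio_mult_sin: "0 \<le> \<theta> \<Longrightarrow> \<theta> < pi \<Longrightarrow> arc_ratio \<theta> * sin \<theta> = \<theta>"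
  using sin_gt_zero[of \<theta>] by (cases "\<theta> = 0") (auto simp: arc_ratio_def)

lemma arc_ratio_pos: "0 \<le> \<theta> \<Longrightarrow> \<theta> < pi \<Longrightarrow> 0 < arc_ratio \<theta>"
  using sin_gt_zero[of \<theta>] by (auto simp: arc_ratio_def)

lemma sphere_log_orthogonal: "norm p = 1 \<Longrightarrow> p \<bullet> sphere_log p q = 0"
  by (simp add: sphere_log_def inner_diff norm_eq_1)

lemma inner_sphere_log:
  assumes "norm p = 1"
  shows "sphere_log p q \<bullet> sphere_log p r =
    arc_ratio (sdist p q) * arc_ratio (sdist p r) * (q \<bullet> r - (p \<bullet> q) * (p \<bullet> r))"
  using assms by (simp add: sphere_log_def inner_diff norm_eq_1 inner_commute algebra_simps)

lemma norm_sphere_log: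
  assumes "norm p = 1" "norm q = 1" "sdist p q < pi"
  shows "norm (sphere_log p q) = sdist p q"
proof -
  let ?d = "sdist p q"
  have "(norm (sphere_log p q))\<^sup>2 = (arc_ratio ?d)\<^sup>2 * (1 - (cos ?d)\<^sup>2)"
    unfolding power2_norm_eq_inner inner_sphere_log[OF assms(1)] using assms(2) cos_sdist[OF assms(1,2)]
    by (simp add: power2_eq_square norm_eq_1)
  also have "\<dots> = (arc_ratio ?d * sin ?d)\<^sup>2"
    by (simp add: sin_squared_eq power_mult_distrib)
  also have "\<dots> = ?d\<^sup>2" using assms by (simp add: arc_ratio_mult_sin sdist_nonneg)
  finally show ?thesis using sdist_nonneg[OF assms(1,2)] by (simp add: power2_eq_iff_nonneg)
qed

lemma mono_square_plus_2cos:
  assumes "0 \<le> e" "e \<le> (d::real)"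
  shows "e\<^sup>2 + 2 * cos e \<le> d\<^sup>2 + 2 * cos d"
proof (rule DERIV_nonneg_imp_nondecreasing[OF assms(2)])
  fix t assume "e \<le> t" "t \<le> d"
  then have "0 \<le> 2 * t - 2 * sin t" using assms sin_x_le_x[of t] by simp
  then show "\<exists>y. ((\<lambda>t. t\<^sup>2 + 2 * cos t) has_real_derivative y) (at t) \<and> 0 \<le> y"
    by (intro exI[of _ "2 * t - 2 * sin t"]) (auto intro!: derivative_eq_intros)
qed

text \<open>The differential of the inverse exponential map stretches the directions orthogonal to the
  radius by \<^const>\<open>arc_ratio\<close> and preserves the radial one. The Lipschitz estimate that this
  suggests follows from the spherical law of cosines alone: if \<open>e\<close> is the difference of the two
  distances from \<open>p\<close> and \<open>d\<close> the distance between the two points, the squared distance of the images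
  is \<open>e\<^sup>2\<close> plus \<open>2 (cos e - cos d)\<close> times a product of two arc ratios.\<close>

lemma sphere_log_lipschitz:
  assumes p: "norm p = 1" and q: "norm q = 1" and r: "norm r = 1"
    and "sdist p q < pi" "sdist p r < pi"
    and "arc_ratio (sdist p q) \<le> \<Phi>" "arc_ratio (sdist p r) \<le> \<Phi>" "1 \<le> \<Phi>"
  shows "norm (sphere_log p q - sphere_log p r) \<le> \<Phi> * sdist q r"
proof (rule power2_le_imp_le)
  let ?a = "sdist p q" and ?b = "sdist p r" and ?d = "sdist q r"
  let ?A = "arc_ratio ?a" and ?B = "arc_ratio ?b"
  let ?e = "\<bar>?a - ?b\<bar>"
  have a: "?A * sin ?a = ?a" and b: "?B * sin ?b = ?b"
    using assms by (auto intro!: arc_ratio_mult_sin sdist_nonneg)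
  have pos: "0 < ?A" "0 < ?B" using assms by (auto intro!: arc_ratio_pos sdist_nonneg)
  have ed: "?e \<le> ?d"
    using sdist_triangle[OF p q r] sdist_triangle[OF p r q] by (simp add: sdist_commute)
  have "(norm (sphere_log p q - sphere_log p r))\<^sup>2 =
      (norm (sphere_log p q))\<^sup>2 + (norm (sphere_log p r))\<^sup>2 - 2 * (sphere_log p q \<bullet> sphere_log p r)"
    unfolding power2_norm_eq_inner by (simp add: inner_diff inner_commute)
  also have "\<dots> = ?a\<^sup>2 + ?b\<^sup>2 - 2 * (?A * ?B * (cos ?d - cos ?a * cos ?b))"
    using assms by (simp add: norm_sphere_log inner_sphere_log cos_sdist)
  also have "?A * ?B * (cos ?d - cos ?a * cos ?b)
      = ?A * ?B * (cos ?d - cos ?e) + (?A * sin ?a) * (?B * sin ?b)"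
    by (simp add: cos_diff algebra_simps)
  also have "?a\<^sup>2 + ?b\<^sup>2 - 2 * \<dots> = ?e\<^sup>2 + ?A * ?B * (2 * cos ?e - 2 * cos ?d)"
    unfolding a b by (simp add: algebra_simps power2_eq_square)
  also have "\<dots> \<le> ?e\<^sup>2 + \<Phi>\<^sup>2 * (2 * cos ?e - 2 * cos ?d)"
  proof -
    have "cos ?d \<le> cos ?e" using ed sdist_le_pi[OF q r] by (intro cos_monotone_0_pi_le) auto
    moreover have "?A * ?B \<le> \<Phi>\<^sup>2"
      unfolding power2_eq_square using assms pos by (intro mult_mono) auto
    ultimately show ?thesis by (simp add: mult_right_mono)
  qed
  also have "\<dots> \<le> \<Phi>\<^sup>2 * ?e\<^sup>2 + \<Phi>\<^sup>2 * (?d\<^sup>2 - ?e\<^sup>2)"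
    using mono_square_plus_2cos[OF _ ed] \<open>1 \<le> \<Phi>\<close>
    by (intro add_mono mult_left_mono) (auto simp: mult_le_cancel_right1 one_le_power)
  also have "\<dots> = (\<Phi> * ?d)\<^sup>2" by (simp add: algebra_simps power_mult_distrib)
  finally show "(norm (sphere_log p q - sphere_log p r))\<^sup>2 \<le> (\<Phi> * ?d)\<^sup>2" .
next
  show "0 \<le> \<Phi> * sdist q r" using assms sdist_nonneg[OF q r] by simp
qed

section \<open>Elementary estimates for sine and cosine\<close>

lemma mult_cos_le_sin:
  assumes "0 \<le> (t::real)" "t \<le> pi / 2"
  shows "t * cos t \<le> sin t"
proof -
  have "sin 0 - 0 * cos 0 \<le> sin t - t * cos t"
  proof (rule DERIV_nonneg_imp_nondecreasing[OF assms(1)])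
    fix s assume s: "0 \<le> s" "s \<le> t"
    then have "0 \<le> s * sin s" using assms by (intro mult_nonneg_nonneg sin_ge_zero) auto
    then show "\<exists>y. ((\<lambda>s. sin s - s * cos s) has_real_derivative y) (at s) \<and> 0 \<le> y"
      by (intro exI[of _ "s * sin s"]) (auto intro!: derivative_eq_intros)
  qed
  then show ?thesis by simp
qed

lemma one_minus_half_square_le_cos: "1 - t\<^sup>2 / 2 \<le> cos (t::real)"
proof (cases "0 \<le> t")
  case True
  then show ?thesis using mono_square_plus_2cos[of 0 t] by simp
next
  case False
  then show ?thesis using mono_square_plus_2cos[of 0 "- t"] by simp
qed

lemma sin_ge_cubic:
  assumes "0 \<le> (t::real)"
  shows "t - t ^ 3 / 6 \<le> sin t"
proof -
  have "sin 0 - (0 - 0 ^ 3 / 6) \<le> sin t - (t - t ^ 3 / 6)"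
  proof (rule DERIV_nonneg_imp_nondecreasing[OF assms])
    fix s :: real
    show "\<exists>y. ((\<lambda>s. sin s - (s - s ^ 3 / 6)) has_real_derivative y) (at s) \<and> 0 \<le> y"
      using one_minus_half_square_le_cos[of s]
      by (intro exI[of _ "cos s - (1 - s\<^sup>2 / 2)"]) (auto intro!: derivative_eq_intros)
  qed
  then show ?thesis by simp
qed

lemma cot_lower_bound_coarse:
  assumes "0 \<le> t" "t \<le> R" "R \<le> pi / 2"
  shows "(1 - R\<^sup>2 / 2) * sin t \<le> t * cos t"
proof -
  have s: "0 \<le> sin t" using assms by (intro sin_ge_zero) auto
  have "t\<^sup>2 \<le> R\<^sup>2" using assms by (intro power_mono) auto
  then have "(1 - R\<^sup>2 / 2) * sin t \<le> cos t * sin t"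
    using one_minus_half_square_le_cos[of t] s by (intro mult_right_mono) auto
  also have "\<dots> \<le> cos t * t"
    using assms by (intro mult_left_mono sin_x_le_x cos_ge_zero) auto
  finally show ?thesis by (simp add: mult.commute)
qed

text \<open>The expansion of \<open>t cot t\<close> starts with \<open>1 - t\<^sup>2 / 3\<close>; the constant \<open>0.36\<close> leaves
  room for the higher terms on the range that is needed below.\<close>

lemma cot_lower_bound_fine:
  fixes t R :: real
  assumes "0 \<le> t" "t \<le> R" "R \<le> 0.615"
  shows "(1 - 0.36 * R\<^sup>2) * sin t \<le> t * cos t"
proof -
  define f where "f = (\<lambda>t::real. t * cos t - (1 - 0.36 * t\<^sup>2) * sin t)"
  have "f 0 \<le> f t"
  proof (rule DERIV_nonneg_imp_nondecreasing[OF assms(1)])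
    fix s assume s: "0 \<le> s" "s \<le> t"
    have "s\<^sup>2 \<le> 0.615\<^sup>2" using s assms by (intro power_mono) auto
    then have "7 / 9 \<le> cos s"
      using one_minus_half_square_le_cos[of s] by (simp add: power2_eq_square)
    then have "0.28 * sin s \<le> 0.36 * (s * cos s)"
      using sin_x_le_x[OF s(1)] mult_left_mono[of "7 / 9" "cos s" s] s by simp
    then have "0 \<le> s * (0.36 * (s * cos s) - 0.28 * sin s)" using s by simp
    then show "\<exists>y. (f has_real_derivative y) (at s) \<and> 0 \<le> y"
      unfolding f_def
      by (intro exI[of _ "s * (0.36 * (s * cos s) - 0.28 * sin s)"])
        (auto intro!: derivative_eq_intros simp: algebra_simps power2_eq_square)
  qed
  then have "(1 - 0.36 * t\<^sup>2) * sin t \<le> t * cos t" by (simp add: f_def)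
  moreover have "t\<^sup>2 \<le> R\<^sup>2" using assms by (intro power_mono) auto
  moreover have "0 \<le> sin t" using assms pi_gt3 by (intro sin_ge_zero) auto
  ultimately show ?thesis
    using mult_right_mono[of "1 - 0.36 * R\<^sup>2" "1 - 0.36 * t\<^sup>2" "sin t"] by simp
qed

lemma arc_ratio_upper_bound:
  fixes t R :: real
  assumes "0 \<le> t" "t \<le> R" "R \<le> 2"
  shows "arc_ratio t \<le> 1 / (1 - R\<^sup>2 / 6)"
proof -
  have "R\<^sup>2 \<le> 2\<^sup>2" using assms by (intro power_mono) auto
  then have R: "0 < 1 - R\<^sup>2 / 6" by simp
  show ?thesis
  proof (cases "t = 0")
    case True
    then show ?thesis using R by (simp add: arc_ratio_def)
  next
    case False
    have "t\<^sup>2 \<le> R\<^sup>2" using assms by (intro power_mono) auto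
    then have "t * (1 - R\<^sup>2 / 6) \<le> t * (1 - t\<^sup>2 / 6)" using assms by (intro mult_left_mono) auto
    also have "\<dots> \<le> sin t"
      using sin_ge_cubic[OF assms(1)] by (simp add: power2_eq_square power3_eq_cube algebra_simps)
    finally have "t * (1 - R\<^sup>2 / 6) \<le> sin t" .
    moreover have "0 < t * (1 - R\<^sup>2 / 6)" using False assms R by simp
    ultimately show ?thesis using False R by (simp add: arc_ratio_def field_simps)
  qed
qed

lemma arc_ratio_mono:
  assumes "0 \<le> s" "s \<le> t" "t < pi / 2"
  shows "arc_ratio s \<le> arc_ratio t"
proof (cases "s = 0")
  case True
  have "sin t > 0" if "t \<noteq> 0" using assms that by (intro sin_gt_zero) auto
  then show ?thesis using True assms sin_x_le_x[of t] by (auto simp: arc_ratio_def)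
next
  case False
  have "s / sin s \<le> t / sin t"
  proof (rule DERIV_nonneg_imp_nondecreasing[OF assms(2)])
    fix r assume r: "s \<le> r" "r \<le> t"
    then have "sin r > 0" using False assms by (intro sin_gt_zero) auto
    moreover have "r * cos r \<le> sin r" using r assms by (intro mult_cos_le_sin) auto
    ultimately show "\<exists>y. ((\<lambda>r. r / sin r) has_real_derivative y) (at r) \<and> 0 \<le> y"
      by (intro exI[of _ "(sin r - r * cos r) / (sin r * sin r)"])
        (auto intro!: derivative_eq_intros)
  qed
  then show ?thesis using False assms by (simp add: arc_ratio_def)
qed

section \<open>Squared distance along geodesics\<close>

text \<open>Along a unit speed geodesic, the second derivative of half the squared distance \<open>\<theta>\<close> to a point
  is \<open>w + (1 - w) \<theta> cot \<theta>\<close>, where \<open>w\<close> is the square of the cosine of the angle between the geodesic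
  and the direction to the point. If the geodesic passes through the point, this holds with \<open>w = 1\<close>,
  but the distance is not differentiable there, and the computation has to be replaced by the
  explicit formula for geodesics through the point.\<close>

lemma half_square_sdist_derivatives:
  fixes p u x :: "'a::euclidean_space" and t :: real
  defines "h \<equiv> \<lambda>s. (sdist (geodesic p u s) x)\<^sup>2 / 2"
    and "k \<equiv> \<lambda>s. - (sphere_log (geodesic p u s) x \<bullet> geodesic u (- p) s)"
    and "\<theta> \<equiv> sdist (geodesic p u t) x"
  assumes tang: "tangent_direction p u" and x: "norm x = 1" and pos: "0 < geodesic p u t \<bullet> x"
  obtains D where "(h has_real_derivative k t) (at t)" "(k has_real_derivative D) (at t)" "D \<le> 1"
    "\<And>\<kappa>. \<kappa> \<le> 1 \<Longrightarrow> \<kappa> * sin \<theta> \<le> \<theta> * cos \<theta> \<Longrightarrow> \<kappa> \<le> D"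
proof -
  define A B where "A = p \<bullet> x" and "B = u \<bullet> x"
  define c c' where "c = (\<lambda>s. cos s * A + sin s * B)" and "c' = (\<lambda>s. cos s * B - sin s * A)"
  have c: "geodesic p u s \<bullet> x = c s" and c': "geodesic u (- p) s \<bullet> x = c' s" for s
    by (simp_all add: c_def c'_def A_def B_def geodesic_def inner_add inner_diff)
  have "0 \<le> (x - A *\<^sub>R p - B *\<^sub>R u) \<bullet> (x - A *\<^sub>R p - B *\<^sub>R u)" by simp
  also have "\<dots> = 1 - (A\<^sup>2 + B\<^sup>2)"
    using tang x unfolding A_def B_def tangent_direction_def norm_eq_1
    by (simp add: inner_diff inner_commute power2_eq_square)
  finally have AB: "A\<^sup>2 + B\<^sup>2 \<le> 1" by simp
  have cc': "(c s)\<^sup>2 + (c' s)\<^sup>2 = A\<^sup>2 + B\<^sup>2" for s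
  proof -
    have "(c s)\<^sup>2 + (c' s)\<^sup>2 = ((cos s)\<^sup>2 + (sin s)\<^sup>2) * (A\<^sup>2 + B\<^sup>2)"
      unfolding c_def c'_def by algebra
    then show ?thesis by simp
  qed
  have n: "norm (geodesic p u s) = 1" for s by (rule norm_geodesic[OF tang])
  have h: "h = (\<lambda>s. (arccos (c s))\<^sup>2 / 2)" by (simp add: h_def sdist_def c)
  have "sphere_log (geodesic p u s) x \<bullet> geodesic u (- p) s = arc_ratio (arccos (c s)) * c' s" for s
  proof -
    have "x \<bullet> geodesic u (- p) s = c' s" by (simp add: c' inner_commute[of x])
    then show ?thesis
      using inner_geodesic_velocity[OF tang, of s]
      by (simp add: sphere_log_def inner_diff sdist_def c)
  qed
  then have k: "k = (\<lambda>s. - (arc_ratio (arccos (c s)) * c' s))" by (simp add: k_def)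
  have \<theta>: "\<theta> = arccos (c t)" by (simp add: \<theta>_def sdist_def c)
  have ct: "0 < c t" using pos c by simp
  show thesis
  proof (cases "A\<^sup>2 + B\<^sup>2 = 1")
    case True
    \<comment> \<open>The geodesic runs through \<open>x\<close>, at the parameter \<open>t0\<close>.\<close>
    define t0 where "t0 = t + arcsin (c' t)"
    have c't: "- 1 < c' t" "c' t < 1" and ct': "c t = sqrt (1 - (c' t)\<^sup>2)"
    proof -
      have e: "(c t)\<^sup>2 = 1 - (c' t)\<^sup>2" using cc'[of t] True by simp
      then show "c t = sqrt (1 - (c' t)\<^sup>2)" using ct by (metis less_imp_le real_sqrt_unique)
      have "(c' t)\<^sup>2 < 1" using e ct by (smt (verit) zero_less_power)
      then have "\<bar>c' t\<bar> < 1" by (simp add: abs_square_less_1)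
      then show "- 1 < c' t" "c' t < 1" by auto
    qed
    have cs: "sin (arcsin (c' t)) = c' t" "cos (arcsin (c' t)) = c t"
      using c't ct' by (simp_all add: cos_arcsin)
    have shift: "c (t + d) = c t * cos d + c' t * sin d"
      "c' (t + d) = c' t * cos d - c t * sin d" for d
      unfolding c_def c'_def cos_add sin_add by (simp_all add: algebra_simps)
    have r: "c s = c t * cos (s - t) + c' t * sin (s - t)"
      "c' s = c' t * cos (s - t) - c t * sin (s - t)" for s
      using shift[of "s - t"] by (metis add.commute diff_add_cancel)+
    have d: "s - t0 = s - t - arcsin (c' t)" for s by (simp add: t0_def)
    have c0: "c s = cos (s - t0)" "c' s = - sin (s - t0)" for s
      unfolding d r[of s] cos_diff[of "s - t"] sin_diff[of "s - t"] cs by simp_all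
    have ac: "arccos (c s) = \<bar>s - t0\<bar>" if "\<bar>s - t0\<bar> < pi" for s
      using that c0 arccos_cos[of "\<bar>s - t0\<bar>"] by simp
    let ?U = "{t0 - pi<..<t0 + pi}"
    have tU: "t \<in> ?U" using arcsin_lt_bounded[OF c't] pi_gt_zero by (auto simp: t0_def)
    have U: "\<bar>s - t0\<bar> < pi" if "s \<in> ?U" for s using that by auto
    have kU: "k s = s - t0" if "s \<in> ?U" for s
      using arc_ratio_mult_sin[of "\<bar>s - t0\<bar>"] U[OF that] ac[OF U[OF that]] c0[of s] sin_minus[of "s - t0"]
      by (auto simp: k arc_ratio_def abs_if split: if_splits)
    have "((\<lambda>s. (s - t0)\<^sup>2 / 2) has_real_derivative t - t0) (at t)"
      by (auto intro!: derivative_eq_intros)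
    then have "(h has_real_derivative t - t0) (at t)"
      by (rule has_field_derivative_transform_within_open[of _ _ _ ?U])
        (use tU ac U in \<open>auto simp: h\<close>)
    moreover have "((\<lambda>s. s - t0) has_real_derivative 1) (at t)"
      by (auto intro!: derivative_eq_intros)
    then have "(k has_real_derivative 1) (at t)"
      by (rule has_field_derivative_transform_within_open[of _ _ _ ?U]) (use tU kU in auto)
    ultimately show thesis using that[of 1] kU[OF tU] by simp
  next
    case False
    then have AB1: "A\<^sup>2 + B\<^sup>2 < 1" using AB by simp
    have c1: "(c s)\<^sup>2 < 1" for s using cc'[of s] AB1 zero_le_power2[of "c' s"] by linarith
    then have c2: "- 1 < c s" "c s < 1" for s
      using abs_square_less_1[of "c s"] by (auto simp: abs_less_iff)
    define S where "S = (\<lambda>s. sqrt (1 - (c s)\<^sup>2))"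
    have Spos: "S s > 0" for s using c1[of s] by (simp add: S_def)
    have sin: "sin (arccos (c s)) = S s" for s
      using c2[of s] by (simp add: S_def sin_arccos)
    have S2: "(S s)\<^sup>2 = 1 - (c s)\<^sup>2" for s using c1[of s] by (simp add: S_def)
    have k2: "k = (\<lambda>s. - (arccos (c s) / S s * c' s))"
    proof
      fix s
      have "arccos (c s) \<noteq> 0" using sin[of s] Spos[of s] by auto
      then show "k s = - (arccos (c s) / S s * c' s)" by (simp add: k arc_ratio_def sin)
    qed
    have dc: "(c has_real_derivative c' s) (at s)" and dc': "(c' has_real_derivative - c s) (at s)" for s
      unfolding c_def c'_def by (auto intro!: derivative_eq_intros)
    have d\<theta>: "((\<lambda>s. arccos (c s)) has_real_derivative - c' t / S t) (at t)"
      using DERIV_chain2[OF DERIV_arccos[OF c2(1)[of t] c2(2)[of t]] dc[of t]]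
      by (simp add: S_def divide_inverse mult.commute)
    have "((\<lambda>s. 1 - (c s)\<^sup>2) has_real_derivative - (2 * c t * c' t)) (at t)"
      using dc[of t] by (auto intro!: derivative_eq_intros)
    from DERIV_chain2[OF DERIV_real_sqrt this] c1[of t]
    have dS: "(S has_real_derivative - (c t * c' t) / S t) (at t)"
      by (simp add: S_def field_simps)
    have "(h has_real_derivative k t) (at t)"
      unfolding h k2 by (rule derivative_eq_intros d\<theta> refl | simp)+
    define w where "w = (c' t)\<^sup>2 / (S t)\<^sup>2"
    define \<psi> where "\<psi> = \<theta> * c t / S t"
    have dk: "(k has_real_derivative w + (1 - w) * \<psi>) (at t)"
    proof -
      have "(k has_real_derivative
          - ((- c' t / S t * S t - \<theta> * (- (c t * c' t) / S t)) / (S t * S t) * c' t + - c t * (\<theta> / S t)))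
          (at t)"
        unfolding k2 \<theta> using Spos[of t] by (intro DERIV_minus DERIV_mult DERIV_divide d\<theta> dS dc') auto
      moreover have "- ((- c' t / S t * S t - \<theta> * (- (c t * c' t) / S t)) / (S t * S t) * c' t
          + - c t * (\<theta> / S t)) = w + (1 - w) * \<psi>"
        using Spos[of t] by (simp add: w_def \<psi>_def field_simps power2_eq_square)
      ultimately show ?thesis by simp
    qed
    have w: "0 \<le> w" "w \<le> 1"
    proof -
      have "(c' t)\<^sup>2 \<le> (S t)\<^sup>2" using cc'[of t] AB S2[of t] by linarith
      then show "0 \<le> w" "w \<le> 1" using Spos[of t] by (simp_all add: w_def)
    qed
    have \<theta>b: "0 \<le> \<theta>" "\<theta> \<le> pi / 2" "cos \<theta> = c t" "sin \<theta> = S t"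
      using c2[of t] ct sin arccos_le_pi2[of "c t"] by (auto simp: \<theta> intro: arccos_lbound)
    have "\<psi> \<le> 1" using mult_cos_le_sin[OF \<theta>b(1,2)] \<theta>b Spos[of t] by (simp add: \<psi>_def)
    then have "(1 - w) * \<psi> \<le> (1 - w) * 1" using w by (intro mult_left_mono) auto
    then have D1: "w + (1 - w) * \<psi> \<le> 1" by simp
    have "\<kappa> \<le> w + (1 - w) * \<psi>" if "\<kappa> \<le> 1" "\<kappa> * sin \<theta> \<le> \<theta> * cos \<theta>" for \<kappa>
    proof -
      have "\<kappa> \<le> \<psi>" using that \<theta>b Spos[of t] by (simp add: \<psi>_def pos_le_divide_eq)
      then have "w * \<kappa> + (1 - w) * \<kappa> \<le> w * 1 + (1 - w) * \<psi>"
        using w that by (intro add_mono mult_left_mono) auto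
      then show ?thesis by (simp add: algebra_simps)
    qed
    then show thesis using that \<open>(h has_real_derivative k t) (at t)\<close> dk D1 by blast
  qed
qed

section \<open>The energy minimised by the scheme\<close>

text \<open>The even and the odd rule of the scheme are mirror images of each other, so both are described
  by the function below: the new point depends on four consecutive data points, listed as
  \<open>a, b, c, d\<close> in such an order that \<open>b\<close> carries the largest weight. The critical points of the
  energy are the zeros of the force, which is minus half its gradient.\<close>

definition scheme_energy :: "'a::euclidean_space \<Rightarrow> 'a \<Rightarrow> 'a \<Rightarrow> 'a \<Rightarrow> 'a \<Rightarrow> real" where
  "scheme_energy a b c d y =
    (21 * (sdist y b)\<^sup>2 + 13 * (sdist y c)\<^sup>2 - (sdist y a)\<^sup>2 - (sdist y d)\<^sup>2) / 32"

definition scheme_force :: "'a::euclidean_space \<Rightarrow> 'a \<Rightarrow> 'a \<Rightarrow> 'a \<Rightarrow> 'a \<Rightarrow> 'a" where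
  "scheme_force a b c d y =
    (1 / 32) *\<^sub>R (21 *\<^sub>R sphere_log y b + 13 *\<^sub>R sphere_log y c - sphere_log y a - sphere_log y d)"

text \<open>Convexity of the energy along a geodesic on which \<open>\<theta> cot \<theta>\<close> is at least \<open>\<kappa>1\<close> for the
  distances to \<open>b\<close> and at least \<open>\<kappa>2\<close> for those to \<open>c\<close>. The terms with negative weights are
  controlled by the upper bound one for the second derivative.\<close>

lemma scheme_energy_along_geodesic:
  fixes p u a b c d :: "'a::euclidean_space"
  defines "\<gamma> \<equiv> geodesic p u" and "\<gamma>' \<equiv> geodesic u (- p)"
  assumes tang: "tangent_direction p u"
    and unit: "norm a = 1" "norm b = 1" "norm c = 1" "norm d = 1"
    and hemi: "\<And>t x. 0 \<le> t \<Longrightarrow> t \<le> L \<Longrightarrow> x \<in> {a, b, c, d} \<Longrightarrow> 0 < \<gamma> t \<bullet> x"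
    and \<kappa>1: "\<kappa>1 \<le> 1" "\<And>t. 0 \<le> t \<Longrightarrow> t \<le> L \<Longrightarrow> \<kappa>1 * sin (sdist (\<gamma> t) b) \<le> sdist (\<gamma> t) b * cos (sdist (\<gamma> t) b)"
    and \<kappa>2: "\<kappa>2 \<le> 1" "\<And>t. 0 \<le> t \<Longrightarrow> t \<le> L \<Longrightarrow> \<kappa>2 * sin (sdist (\<gamma> t) c) \<le> sdist (\<gamma> t) c * cos (sdist (\<gamma> t) c)"
  shows scheme_energy_deriv: "\<And>t. 0 \<le> t \<Longrightarrow> t \<le> L \<Longrightarrow>
      ((\<lambda>t. scheme_energy a b c d (\<gamma> t)) has_real_derivative
         - 2 * (scheme_force a b c d (\<gamma> t) \<bullet> \<gamma>' t)) (at t)"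
    and scheme_force_monotone: "\<And>s t. 0 \<le> s \<Longrightarrow> s \<le> t \<Longrightarrow> t \<le> L \<Longrightarrow>
      (21 * \<kappa>1 + 13 * \<kappa>2 - 2) / 32 * (t - s) \<le>
        scheme_force a b c d (\<gamma> s) \<bullet> \<gamma>' s - scheme_force a b c d (\<gamma> t) \<bullet> \<gamma>' t"
proof -
  define h where "h = (\<lambda>x t. (sdist (\<gamma> t) x)\<^sup>2 / 2)"
  define k where "k = (\<lambda>x t. - (sphere_log (\<gamma> t) x \<bullet> \<gamma>' t))"
  define \<mu> where "\<mu> = (21 * \<kappa>1 + 13 * \<kappa>2 - 2) / 32"
  have energy: "(\<lambda>t. scheme_energy a b c d (\<gamma> t)) =
      (\<lambda>t. (21 * h b t + 13 * h c t - h a t - h d t) / 16)"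
    by (simp add: fun_eq_iff scheme_energy_def h_def)
  have force: "scheme_force a b c d (\<gamma> t) \<bullet> \<gamma>' t = - ((21 * k b t + 13 * k c t - k a t - k d t) / 32)"
    for t
    by (simp add: scheme_force_def k_def inner_add_left inner_diff_left field_simps)
  have derivs: "\<exists>D. (h x has_real_derivative k x t) (at t) \<and> (k x has_real_derivative D) (at t) \<and> D \<le> 1 \<and>
      (\<forall>\<kappa>. \<kappa> \<le> 1 \<longrightarrow> \<kappa> * sin (sdist (\<gamma> t) x) \<le> sdist (\<gamma> t) x * cos (sdist (\<gamma> t) x) \<longrightarrow> \<kappa> \<le> D)"
    if "0 \<le> t" "t \<le> L" "x \<in> {a, b, c, d}" for x t
  proof -
    have "norm x = 1" using that unit by auto
    then show ?thesis unfolding h_def k_def \<gamma>_def \<gamma>'_def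
      by (rule half_square_sdist_derivatives[OF tang _ hemi[OF that, unfolded \<gamma>_def]]) blast
  qed
  show "((\<lambda>t. scheme_energy a b c d (\<gamma> t)) has_real_derivative
         - 2 * (scheme_force a b c d (\<gamma> t) \<bullet> \<gamma>' t)) (at t)" if t: "0 \<le> t" "t \<le> L" for t
  proof -
    have dh: "(h x has_real_derivative k x t) (at t)" if "x \<in> {a, b, c, d}" for x
      using derivs[OF t that] by blast
    have "((\<lambda>t. (21 * h b t + 13 * h c t - h a t - h d t) / 16) has_real_derivative
        (21 * k b t + 13 * k c t - k a t - k d t) / 16) (at t)"
      by (intro DERIV_cdivide DERIV_diff DERIV_add DERIV_cmult dh) auto
    moreover have "- 2 * - (z / 32) = z / 16" for z :: real by simp
    ultimately show ?thesis unfolding energy force by (simp only:)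
  qed
  show "(21 * \<kappa>1 + 13 * \<kappa>2 - 2) / 32 * (t - s) \<le>
        scheme_force a b c d (\<gamma> s) \<bullet> \<gamma>' s - scheme_force a b c d (\<gamma> t) \<bullet> \<gamma>' t"
    if st: "0 \<le> s" "s \<le> t" "t \<le> L" for s t
  proof -
    have "- (scheme_force a b c d (\<gamma> s) \<bullet> \<gamma>' s) - \<mu> * s \<le> - (scheme_force a b c d (\<gamma> t) \<bullet> \<gamma>' t) - \<mu> * t"
    proof (rule DERIV_nonneg_imp_nondecreasing[OF st(2)])
      fix r assume "s \<le> r" "r \<le> t"
      then have r: "0 \<le> r" "r \<le> L" using st by auto
      obtain Da where Da: "(k a has_real_derivative Da) (at r)" "Da \<le> 1"
        using derivs[OF r, of a] by blast
      obtain Db where Db: "(k b has_real_derivative Db) (at r)" "\<kappa>1 \<le> Db"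
        using derivs[OF r, of b] \<kappa>1(1) \<kappa>1(2)[OF r] by blast
      obtain Dc where Dc: "(k c has_real_derivative Dc) (at r)" "\<kappa>2 \<le> Dc"
        using derivs[OF r, of c] \<kappa>2(1) \<kappa>2(2)[OF r] by blast
      obtain Dd where Dd: "(k d has_real_derivative Dd) (at r)" "Dd \<le> 1"
        using derivs[OF r, of d] by blast
      have "((\<lambda>r. - (scheme_force a b c d (\<gamma> r) \<bullet> \<gamma>' r) - \<mu> * r) has_real_derivative
          (21 * Db + 13 * Dc - Da - Dd) / 32 - \<mu>) (at r)"
        unfolding force minus_minus using DERIV_cmult[OF DERIV_ident, of \<mu>]
        by (intro DERIV_cdivide DERIV_diff DERIV_add DERIV_cmult Da Db Dc Dd) auto
      moreover have "0 \<le> (21 * Db + 13 * Dc - Da - Dd) / 32 - \<mu>"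
        using Da Db Dc Dd by (simp add: \<mu>_def)
      ultimately show "\<exists>y. ((\<lambda>r. - (scheme_force a b c d (\<gamma> r) \<bullet> \<gamma>' r) - \<mu> * r)
          has_real_derivative y) (at r) \<and> 0 \<le> y" by blast
    qed
    then show ?thesis unfolding \<mu>_def[symmetric] by (simp add: algebra_simps)
  qed
qed

lemma inner_pos_of_sdist_le:
  assumes "norm x = 1" "norm y = 1" "sdist x y \<le> 1.5"
  shows "0 < y \<bullet> x"
proof -
  have "0 < cos (sdist x y)"
    using assms sdist_nonneg[of x y] pi_gt3 by (intro cos_gt_zero_pi) auto
  then show ?thesis using cos_sdist[of x y] assms by (simp add: inner_commute)
qed

text \<open>The component of the force along the geodesic from \<open>y\<close> to the zero \<open>z\<close> decreases to zero at no
  less than the rate given by convexity, so it starts from at least the rate times the distance. This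
  quantitative form of uniqueness is used both to locate new points and to compare two of them.\<close>

lemma scheme_force_stability:
  fixes y z a b c d :: "'a::euclidean_space"
  assumes unit: "norm a = 1" "norm b = 1" "norm c = 1" "norm d = 1" "norm y = 1" "norm z = 1"
    and b: "sdist b y \<le> R1" "sdist b z \<le> R1" "R1 \<le> 0.615"
    and c: "sdist c y \<le> R2" "sdist c z \<le> R2" "R2 \<le> 0.615"
    and ad: "sdist a y \<le> 1.5" "sdist a z \<le> 1.5" "sdist d y \<le> 1.5" "sdist d z \<le> 1.5"
    and zero: "scheme_force a b c d z = 0"
  shows "(32 - 7.56 * R1\<^sup>2 - 4.68 * R2\<^sup>2) / 32 * sdist y z \<le> norm (scheme_force a b c d y)"
proof (cases "sdist y z = 0")
  case False
  let ?L = "sdist y z"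
  have L: "0 < ?L" using False sdist_nonneg[of y z] unit by simp
  have Lpi: "?L < pi"
    using sdist_triangle[of y b z] unit b pi_gt3 by (simp add: sdist_commute[of y b])
  obtain u where u: "tangent_direction y u" and zu: "geodesic y u ?L = z"
    by (rule geodesic_between[OF unit(5,6) refl L Lpi])
  have n: "norm (geodesic y u t) = 1" for t by (rule norm_geodesic[OF u])
  have R: "0 \<le> R1" "0 \<le> R2" using b c sdist_nonneg[of b y] sdist_nonneg[of c y] unit by auto
  have near: "sdist x (geodesic y u t) \<le> R"
    if "0 \<le> t" "t \<le> ?L" "norm x = 1" "sdist x y \<le> R" "sdist x z \<le> R" "R \<le> 1.5" for x t R
    using that sdist_geodesic_le[OF u that(3) L Lpi that(1,2), of R] zu pi_gt3
      sdist_nonneg[of x y] unit by auto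
  have hemi: "0 < geodesic y u t \<bullet> x" if t: "0 \<le> t" "t \<le> ?L" and x: "x \<in> {a, b, c, d}" for t x
  proof -
    have "norm x = 1 \<and> sdist x y \<le> 1.5 \<and> sdist x z \<le> 1.5" using x unit ad b c by auto
    then show ?thesis using near[OF t, of x "1.5"] inner_pos_of_sdist_le[of x] n by auto
  qed
  have \<kappa>: "(1 - 0.36 * R\<^sup>2) * sin (sdist (geodesic y u t) x)
      \<le> sdist (geodesic y u t) x * cos (sdist (geodesic y u t) x)"
    if "0 \<le> t" "t \<le> ?L" "norm x = 1" "sdist x y \<le> R" "sdist x z \<le> R" "R \<le> 0.615" for x t R
    using near[OF that(1-5)] that n sdist_nonneg[of "geodesic y u t" x]
    by (intro cot_lower_bound_fine) (auto simp: sdist_commute)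
  have "(21 * (1 - 0.36 * R1\<^sup>2) + 13 * (1 - 0.36 * R2\<^sup>2) - 2) / 32 * (?L - 0) \<le>
      scheme_force a b c d (geodesic y u 0) \<bullet> geodesic u (- y) 0
      - scheme_force a b c d (geodesic y u ?L) \<bullet> geodesic u (- y) ?L"
    by (rule scheme_force_monotone[OF u unit(1-4), where L = ?L])
      (use hemi \<kappa>[of _ b R1] \<kappa>[of _ c R2] L b c unit in auto)
  also have "\<dots> = scheme_force a b c d y \<bullet> u" using zero zu by simp
  also have "\<dots> \<le> norm (scheme_force a b c d y)"
    using norm_cauchy_schwarz[of "scheme_force a b c d y" u] u by (simp add: tangent_direction_def)
  finally show ?thesis by (simp add: algebra_simps)
qed simp

section \<open>Critical points of the energy\<close>

lemma norm_scheme_force_le: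
  "norm (scheme_force a b c d y) \<le>
    (21 * norm (sphere_log y b) + 13 * norm (sphere_log y c) + norm (sphere_log y a) + norm (sphere_log y d)) / 32"
proof -
  have "norm (21 *\<^sub>R sphere_log y b + 13 *\<^sub>R sphere_log y c - sphere_log y a - sphere_log y d)
    \<le> norm (21 *\<^sub>R sphere_log y b) + norm (13 *\<^sub>R sphere_log y c) + norm (sphere_log y a) + norm (sphere_log y d)"
    by (meson norm_add_leD norm_triangle_ineq norm_triangle_ineq4 order_trans add_mono order_refl)
  then show ?thesis by (simp add: scheme_force_def)
qed

lemma sphere_log_self: "norm p = 1 \<Longrightarrow> sphere_log p p = 0"
  by (simp add: sphere_log_def norm_eq_1)

text \<open>A data point exerts no force on itself, and the other ones act with their distances, which are
  at most \<open>\<delta>\<close> or \<open>2 \<delta>\<close>, times their weights.\<close>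

lemma norm_scheme_force_at_b:
  assumes unit: "norm a = 1" "norm b = 1" "norm c = 1" "norm d = 1"
    and \<delta>: "sdist a b \<le> \<delta>" "sdist b c \<le> \<delta>" "sdist c d \<le> \<delta>" "\<delta> \<le> 1"
  shows "norm (scheme_force a b c d b) \<le> \<delta> / 2"
proof -
  have "sdist b a \<le> \<delta>" "sdist b d \<le> 2 * \<delta>"
    using \<delta> sdist_triangle[of b c d] unit by (auto simp: sdist_commute)
  then show ?thesis
    using norm_scheme_force_le[of a b c d b] unit \<delta> pi_gt3
    by (simp add: norm_sphere_log sphere_log_self)
qed

lemma norm_scheme_force_at_c:
  assumes unit: "norm a = 1" "norm b = 1" "norm c = 1" "norm d = 1"
    and \<delta>: "sdist a b \<le> \<delta>" "sdist b c \<le> \<delta>" "sdist c d \<le> \<delta>" "\<delta> \<le> 1"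
  shows "norm (scheme_force a b c d c) \<le> 3 * \<delta> / 4"
proof -
  have "sdist c b \<le> \<delta>" "sdist c a \<le> 2 * \<delta>"
    using \<delta> sdist_triangle[of c b a] unit by (auto simp: sdist_commute)
  then show ?thesis
    using norm_scheme_force_le[of a b c d c] unit \<delta> pi_gt3
    by (simp add: norm_sphere_log sphere_log_self)
qed

lemma data_near_ball_around_b:
  assumes unit: "norm a = 1" "norm b = 1" "norm c = 1" "norm d = 1" "norm y = 1"
    and \<delta>: "sdist a b \<le> 0.4" "sdist b c \<le> 0.4" "sdist c d \<le> 0.4"
    and y: "sdist y b \<le> 0.215"
  shows "sdist a y \<le> 0.615" "sdist b y \<le> 0.215" "sdist c y \<le> 0.615" "sdist d y \<le> 1.015"
  using assms sdist_triangle[of a b y] sdist_triangle[of c b y] sdist_triangle[of d c y]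
  by (auto simp: sdist_commute)

text \<open>The energy has a minimum on a small closed ball around \<open>b\<close>. It is not attained on the boundary,
  since there the force points inwards: the force at \<open>b\<close> is small, and along the radii its outward
  component decreases at a rate close to one. An interior minimum is a zero of the force. The radius
  \<open>0.215\<close> is slightly larger than the quotient of the bound \<open>0.2\<close> for the force at \<open>b\<close> and the
  convexity modulus \<open>0.9337\<close>.\<close>

lemma scheme_force_zero_exists:
  fixes a b c d :: "'a::euclidean_space"
  assumes unit: "norm a = 1" "norm b = 1" "norm c = 1" "norm d = 1"
    and \<delta>: "sdist a b \<le> 0.4" "sdist b c \<le> 0.4" "sdist c d \<le> 0.4"
  obtains y where "norm y = 1" "sdist y b \<le> 0.215" "scheme_force a b c d y = 0"
proof -
  define K where "K = {y \<in> sphere 0 1. sdist y b \<le> 0.215}"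
  let ?E = "scheme_energy a b c d" and ?F = "scheme_force a b c d"
  have KI: "y \<in> K" if "norm y = 1" "sdist y b \<le> 0.215" for y using that by (simp add: K_def)
  have near: "norm y = 1 \<and> sdist a y \<le> 0.615 \<and> sdist b y \<le> 0.215 \<and> sdist c y \<le> 0.615 \<and> sdist d y \<le> 1.015"
    if "y \<in> K" for y using data_near_ball_around_b[OF unit(1-4) _ \<delta>, of y] that by (auto simp: K_def)
  have pos: "0 < y \<bullet> x" if "y \<in> K" "x \<in> {a, b, c, d}" for x y
  proof -
    have "norm x = 1 \<and> sdist x y \<le> 1.5" using near[OF that(1)] that(2) unit by auto
    then show ?thesis using inner_pos_of_sdist_le[of x y] near[OF that(1)] by auto
  qed
  have \<kappa>: "(1 - 0.36 * R\<^sup>2) * sin (sdist y x) \<le> sdist y x * cos (sdist y x)"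
    if "norm y = 1" "norm x = 1" "sdist x y \<le> R" "R \<le> 0.615" for x y R
    using that sdist_nonneg[of y x] by (intro cot_lower_bound_fine) (auto simp: sdist_commute)
  have "K = sphere 0 1 \<inter> (\<lambda>y. sdist y b) -` {..0.215}" by (auto simp: K_def)
  then have "closed K"
    using continuous_closed_preimage[OF continuous_on_sdist[OF unit(2)] closed_sphere closed_atMost]
    by simp
  then have "compact K"
    by (auto simp: compact_eq_bounded_closed K_def intro: bounded_subset[OF bounded_sphere[of 0 1]])
  moreover have "b \<in> K" using unit by (simp add: K_def sdist_self)
  moreover have "continuous_on K ?E"
    unfolding scheme_energy_def
    by (intro continuous_intros continuous_on_subset[OF continuous_on_sdist]) (auto simp: K_def unit)
  ultimately obtain y where y: "y \<in> K" and min: "\<And>z. z \<in> K \<Longrightarrow> ?E y \<le> ?E z"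
    by (metis continuous_attains_inf empty_iff)
  have y1: "norm y = 1" and yb: "sdist y b \<le> 0.215" using y by (auto simp: K_def)
  have "sdist y b \<noteq> 0.215"
  proof
    assume r: "sdist y b = 0.215"
    then have r': "sdist b y = 0.215" by (simp add: sdist_commute)
    obtain u where u: "tangent_direction b u" and yu: "geodesic b u 0.215 = y"
      by (rule geodesic_between[OF unit(2) y1 r']) (use pi_gt3 in auto)
    have inK: "geodesic b u t \<in> K" if "0 \<le> t" "t \<le> 0.215" for t
      using sdist_start_geodesic[OF u, of t] that pi_gt3
      by (intro KI) (auto simp: norm_geodesic[OF u] sdist_commute)
    have hyps: "0 < geodesic b u t \<bullet> x" if "0 \<le> t" "t \<le> 0.215" "x \<in> {a, b, c, d}" for t x
      using pos inK that by blast
    have \<kappa>b: "(1 - 0.36 * 0.215\<^sup>2) * sin (sdist (geodesic b u t) b)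
        \<le> sdist (geodesic b u t) b * cos (sdist (geodesic b u t) b)"
      and \<kappa>c: "(1 - 0.36 * 0.615\<^sup>2) * sin (sdist (geodesic b u t) c)
        \<le> sdist (geodesic b u t) c * cos (sdist (geodesic b u t) c)"
      if "0 \<le> t" "t \<le> 0.215" for t
      using near[OF inK[OF that]] unit
        \<kappa>[of "geodesic b u t" b "0.215"] \<kappa>[of "geodesic b u t" c "0.615"] by simp_all
    note along = u unit hyps _ \<kappa>b _ \<kappa>c
    have "(21 * (1 - 0.36 * 0.215\<^sup>2) + 13 * (1 - 0.36 * 0.615\<^sup>2) - 2) / 32 * (0.215 - 0) \<le>
        ?F (geodesic b u 0) \<bullet> geodesic u (- b) 0 - ?F y \<bullet> geodesic u (- b) 0.215"
      unfolding yu[symmetric] by (rule scheme_force_monotone[where L = "0.215", OF along]) auto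
    \<comment> \<open>The outward component of the force at \<open>b\<close> is too small to stay nonnegative up to \<open>y\<close>.\<close>
    moreover have "?F b \<bullet> u \<le> 0.2"
    proof -
      have "?F b \<bullet> u \<le> norm (?F b)"
        using norm_cauchy_schwarz[of "?F b" u] u by (simp add: tangent_direction_def)
      also have "\<dots> \<le> 0.2" using norm_scheme_force_at_b[OF unit \<delta>] by simp
      finally show ?thesis .
    qed
    ultimately have "?F y \<bullet> geodesic u (- b) 0.215 < 0" by (simp add: power2_eq_square)
    moreover have "((\<lambda>t. ?E (geodesic b u t)) has_real_derivative
        - 2 * (?F y \<bullet> geodesic u (- b) 0.215)) (at 0.215)"
      unfolding yu[symmetric] by (rule scheme_energy_deriv[where L = "0.215", OF along]) auto
    ultimately obtain e where e: "e > 0"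
      "\<And>h. 0 < h \<Longrightarrow> h < e \<Longrightarrow> ?E (geodesic b u (0.215 - h)) < ?E (geodesic b u 0.215)"
      using DERIV_pos_inc_left by (metis mult_neg_neg neg_less_0_iff_less zero_less_numeral)
    define h where "h = min (e / 2) 0.1"
    have "?E (geodesic b u (0.215 - h)) < ?E y" unfolding yu[symmetric] using e(1) by (intro e(2)) (auto simp: h_def)
    moreover have "geodesic b u (0.215 - h) \<in> K" using e(1) by (intro inK) (auto simp: h_def)
    ultimately show False using min by force
  qed
  then have yb': "sdist y b < 0.215" using yb by simp
  have "?F y = 0"
  proof (rule ccontr)
    \<comment> \<open>Otherwise the energy would decrease along the geodesic in the direction of the force.\<close>
    assume F: "?F y \<noteq> 0"
    define u where "u = (1 / norm (?F y)) *\<^sub>R ?F y"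
    have "y \<bullet> ?F y = 0"
      using y1 by (simp add: scheme_force_def inner_add_right inner_diff_right sphere_log_orthogonal)
    then have u: "tangent_direction y u" using F y1 by (simp add: tangent_direction_def u_def)
    define L where "L = 0.215 - sdist y b"
    have L: "0 < L" "L < pi" using yb' sdist_nonneg[OF y1 unit(2)] pi_gt3 by (auto simp: L_def)
    have inK: "geodesic y u t \<in> K" if "0 \<le> t" "t \<le> L" for t
      using sdist_start_geodesic[OF u, of t] sdist_triangle[of "geodesic y u t" y b] that L
        norm_geodesic[OF u, of t] unit y1
      by (intro KI) (auto simp: sdist_commute L_def)
    have hyps: "0 < geodesic y u t \<bullet> x" if "0 \<le> t" "t \<le> L" "x \<in> {a, b, c, d}" for t x
      using pos inK that by blast
    have \<kappa>b: "(1 - 0.36 * 0.215\<^sup>2) * sin (sdist (geodesic y u t) b)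
        \<le> sdist (geodesic y u t) b * cos (sdist (geodesic y u t) b)"
      and \<kappa>c: "(1 - 0.36 * 0.615\<^sup>2) * sin (sdist (geodesic y u t) c)
        \<le> sdist (geodesic y u t) c * cos (sdist (geodesic y u t) c)"
      if "0 \<le> t" "t \<le> L" for t
      using near[OF inK[OF that]] unit
        \<kappa>[of "geodesic y u t" b "0.215"] \<kappa>[of "geodesic y u t" c "0.615"] by simp_all
    have "((\<lambda>t. ?E (geodesic y u t)) has_real_derivative
        - 2 * (?F (geodesic y u 0) \<bullet> geodesic u (- y) 0)) (at 0)"
      by (rule scheme_energy_deriv[where L = L, OF u unit hyps _ \<kappa>b _ \<kappa>c]) (use L in auto)
    moreover have "0 < ?F y \<bullet> u" using F by (simp add: u_def)
    ultimately obtain e where e: "e > 0"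
      "\<And>h. 0 < h \<Longrightarrow> h < e \<Longrightarrow> ?E (geodesic y u (0 + h)) < ?E (geodesic y u 0)"
      using DERIV_neg_dec_right[of "\<lambda>t. ?E (geodesic y u t)" "- 2 * (?F y \<bullet> u)" 0] by auto
    define h where "h = min (e / 2) L"
    have "?E (geodesic y u h) < ?E y" using e(2)[of h] e(1) L by (auto simp: h_def)
    moreover have "geodesic y u h \<in> K" using e(1) L by (intro inK) (auto simp: h_def)
    ultimately show False using min by force
  qed
  then show thesis using that y1 yb by blast
qed

text \<open>Stability, applied to \<open>c\<close> and the zero \<open>y\<close>, improves the bound \<open>0.615\<close> that the
  triangle inequality gives. With the weaker bound the estimate of the contraction factor for adjacent
  edges would exceed one.\<close>

lemma scheme_force_zero_near_c:
  fixes a b c d y :: "'a::euclidean_space"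
  assumes unit: "norm a = 1" "norm b = 1" "norm c = 1" "norm d = 1" "norm y = 1"
    and \<delta>: "sdist a b \<le> 0.4" "sdist b c \<le> 0.4" "sdist c d \<le> 0.4"
    and y: "sdist y b \<le> 0.215" "scheme_force a b c d y = 0"
  shows "sdist y c \<le> 0.335"
proof -
  have "sdist a c \<le> 0.8" using sdist_triangle[of a b c] unit \<delta> by simp
  then have "(32 - 7.56 * 0.4\<^sup>2 - 4.68 * 0.615\<^sup>2) / 32 * sdist c y \<le> norm (scheme_force a b c d c)"
    using data_near_ball_around_b[OF unit \<delta> y(1)] unit \<delta> y
    by (intro scheme_force_stability) (auto simp: sdist_self sdist_commute)
  also have "\<dots> \<le> 0.3" using norm_scheme_force_at_c[OF unit(1-4) \<delta>] by simp
  finally show ?thesis by (simp add: power2_eq_square sdist_commute)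
qed

lemma scheme_force_zero_displacement:
  fixes a b c d y :: "'a::euclidean_space"
  assumes unit: "norm a = 1" "norm b = 1" "norm c = 1" "norm d = 1" "norm y = 1"
    and \<delta>: "sdist a b \<le> \<delta>" "sdist b c \<le> \<delta>" "sdist c d \<le> \<delta>" "\<delta> \<le> 0.4"
    and y: "sdist y b \<le> 0.215" "scheme_force a b c d y = 0"
  shows "sdist y b \<le> \<delta>"
proof -
  have \<delta>': "sdist a b \<le> 0.4" "sdist b c \<le> 0.4" "sdist c d \<le> 0.4" using \<delta> by auto
  have "sdist d b \<le> 0.8" using sdist_triangle[of d c b] unit \<delta>' by (simp add: sdist_commute)
  then have "(32 - 7.56 * 0.215\<^sup>2 - 4.68 * 0.615\<^sup>2) / 32 * sdist b y \<le> norm (scheme_force a b c d b)"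
    using data_near_ball_around_b[OF unit \<delta>' y(1)] unit \<delta>' y
    by (intro scheme_force_stability) (auto simp: sdist_self sdist_commute)
  also have "\<dots> \<le> \<delta> / 2" using norm_scheme_force_at_b[OF unit(1-4) \<delta>(1-3)] \<delta> by simp
  finally show ?thesis using sdist_nonneg[of b y] unit by (simp add: power2_eq_square sdist_commute)
qed

section \<open>The new points of the Riemannian scheme\<close>

text \<open>As in Euclidean space, a point of the ball of radius \<open>\<rho>\<close> around \<open>p\<close> pulls a point outside of
  the ball towards \<open>p\<close> at least as strongly as the nearest boundary point of the ball does. The law
  of cosines bounds the pull from below by an increasing function of the distance of the two points,
  and this distance is least for the boundary point.\<close>

lemma inward_pull:
  fixes p u x :: "'a::euclidean_space"
  assumes u: "tangent_direction p u" and x: "norm x = 1" and px: "sdist p x \<le> \<rho>"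
    and r: "\<rho> < r" "r + \<rho> < pi / 2"
  shows "r - \<rho> \<le> - (sphere_log (geodesic p u r) x \<bullet> geodesic u (- p) r)"
proof -
  let ?y = "geodesic p u r" and ?v = "geodesic u (- p) r"
  let ?a = "sdist p x" and ?d = "sdist (geodesic p u r) x"
  have p1: "norm p = 1" using u by (simp add: tangent_direction_def)
  have y1: "norm ?y = 1" by (rule norm_geodesic[OF u])
  have a: "0 \<le> ?a" "?a < r" using px r sdist_nonneg[OF p1 x] by auto
  have r0: "0 < r" "r < pi / 2" using a r px by auto
  have "sdist p ?y = r" using sdist_start_geodesic[OF u, of r] r0 by auto
  then have d: "r - ?a \<le> ?d" "?d < pi / 2"
    using sdist_triangle[OF p1 x y1] sdist_triangle[OF y1 p1 x] px r by (auto simp: sdist_commute)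
  have "p = cos r *\<^sub>R ?y - sin r *\<^sub>R ?v"
  proof -
    have "cos r *\<^sub>R ?y - sin r *\<^sub>R ?v = (cos r * cos r + sin r * sin r) *\<^sub>R p"
      unfolding geodesic_def by (simp add: algebra_simps del: sin_cos_squared_add3)
    then show ?thesis by (simp only: sin_cos_squared_add3 scaleR_one)
  qed
  then have "p \<bullet> x = cos r * (?y \<bullet> x) - sin r * (?v \<bullet> x)"
    by (metis inner_diff_left inner_scaleR_left)
  then have "sin r * - (?v \<bullet> x) = cos ?a - cos r * cos ?d"
    using cos_sdist[OF p1 x] cos_sdist[OF y1 x] by simp
  also have "\<dots> \<ge> cos ?a - cos r * cos (r - ?a)"
    using d a r0 cos_ge_zero[of r] by (intro diff_left_mono mult_left_mono cos_monotone_0_pi_le) auto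
  moreover have "cos ?a - cos r * cos (r - ?a) = sin r * sin (r - ?a)"
    using cos_diff[of r "r - ?a"] by simp
  ultimately have "sin r * sin (r - ?a) \<le> sin r * - (?v \<bullet> x)" by simp
  moreover have "0 < sin r" using r0 by (intro sin_gt_zero) auto
  ultimately have v: "sin (r - ?a) \<le> - (?v \<bullet> x)" by (simp only: mult_le_cancel_left_pos)
  have "r - \<rho> \<le> r - ?a" using px by simp
  also have "\<dots> = arc_ratio (r - ?a) * sin (r - ?a)"
    using arc_ratio_mult_sin[of "r - ?a"] a r0 by simp
  also have "\<dots> \<le> arc_ratio ?d * - (?v \<bullet> x)"
  proof (intro mult_mono v)
    show "arc_ratio (r - ?a) \<le> arc_ratio ?d" using d a by (intro arc_ratio_mono) auto
    show "0 \<le> arc_ratio ?d" using arc_ratio_pos[of ?d] d a by simp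
    show "0 \<le> sin (r - ?a)" using a r0 by (intro sin_ge_zero) auto
  qed
  also have "\<dots> = - (sphere_log ?y x \<bullet> ?v)"
    using inner_geodesic_velocity[OF u, of r]
    by (simp add: sphere_log_def inner_diff inner_commute)
  finally show ?thesis .
qed

text \<open>The zero of the force near \<open>b\<close> lies in every admissible ball: otherwise the points with
  positive coefficients, of total weight \<open>34 / 32\<close>, would pull it inwards by more than the others,
  of total weight \<open>2 / 32\<close>, can pull it outwards.\<close>

lemma scheme_force_zero_in_ball:
  fixes p y a b c d :: "'a::euclidean_space"
  assumes unit: "norm a = 1" "norm b = 1" "norm c = 1" "norm d = 1" "norm p = 1" "norm y = 1"
    and \<rho>: "\<And>x. x \<in> {a, b, c, d} \<Longrightarrow> sdist p x < \<rho>" "9 / 8 * \<rho> < \<rho>'" "\<rho>' < 0.677"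
    and y: "sdist y b \<le> 0.215" "scheme_force a b c d y = 0"
  shows "sdist p y < \<rho>'"
proof (rule ccontr)
  assume neg: "\<not> sdist p y < \<rho>'"
  define r where "r = sdist p y"
  have \<rho>0: "0 < \<rho>" using \<rho>(1)[of b] sdist_nonneg[of p b] unit by auto
  have r: "9 / 8 * \<rho> < r" using neg \<rho> by (simp add: r_def)
  have "r < 0.215 + \<rho>"
    using sdist_triangle[of p b y] \<rho>(1)[of b] y(1) unit by (simp add: r_def sdist_commute)
  then have r2: "r + \<rho> < pi / 2" using \<rho> pi_gt3 by simp
  obtain u where u: "tangent_direction p u" and yu: "geodesic p u r = y"
    by (rule geodesic_between[OF unit(5,6) r_def[symmetric]]) (use r r2 \<rho>0 pi_gt3 in auto)
  let ?v = "geodesic u (- p) r"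
  have pull: "r - \<rho> \<le> - (sphere_log y x \<bullet> ?v)" if "x \<in> {b, c}" for x
  proof -
    have "norm x = 1" "sdist p x \<le> \<rho>" using that unit \<rho>(1)[of x] by auto
    then show ?thesis unfolding yu[symmetric] using r r2 \<rho>0 by (intro inward_pull[OF u]) auto
  qed
  have push: "- (r + \<rho>) \<le> sphere_log y x \<bullet> ?v" if "x \<in> {a, d}" for x
  proof -
    have x: "norm x = 1" "sdist p x \<le> \<rho>" using that unit \<rho>(1)[of x] by auto
    have "sdist y x \<le> r + \<rho>"
      using sdist_triangle[of y p x] x unit by (simp add: r_def sdist_commute)
    moreover have "\<bar>sphere_log y x \<bullet> ?v\<bar> \<le> sdist y x"
      using Cauchy_Schwarz_ineq2[of "sphere_log y x" ?v] norm_velocity[OF u] x unit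
        norm_sphere_log[of y x] calculation r2 pi_gt_zero by simp
    ultimately show ?thesis by simp
  qed
  have "0 = scheme_force a b c d y \<bullet> ?v" using y by simp
  also have "\<dots> = (21 * (sphere_log y b \<bullet> ?v) + 13 * (sphere_log y c \<bullet> ?v)
      - sphere_log y a \<bullet> ?v - sphere_log y d \<bullet> ?v) / 32"
    by (simp add: scheme_force_def inner_add_left inner_diff_left)
  also have "\<dots> \<le> (- 34 * (r - \<rho>) + 2 * (r + \<rho>)) / 32"
    using pull[of b] pull[of c] push[of a] push[of d] by simp
  finally show False using r by simp
qed

text \<open>In an admissible ball all distances to the data points are less than \<open>1.279\<close>. Up to this
  distance the energy is strictly convex along geodesics.\<close>

lemma scheme_force_zero_minimises:
  fixes p y z a b c d :: "'a::euclidean_space"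
  assumes unit: "norm a = 1" "norm b = 1" "norm c = 1" "norm d = 1" "norm p = 1" "norm y = 1" "norm z = 1"
    and \<rho>: "\<And>x. x \<in> {a, b, c, d} \<Longrightarrow> sdist p x < \<rho>" "9 / 8 * \<rho> < \<rho>'" "\<rho>' < 0.677"
    and y: "scheme_force a b c d y = 0"
    and ball: "sdist p y < \<rho>'" "sdist p z < \<rho>'" and "z \<noteq> y"
  shows "scheme_energy a b c d y < scheme_energy a b c d z"
proof -
  let ?E = "scheme_energy a b c d" and ?F = "scheme_force a b c d"
  define L where "L = sdist y z"
  have L: "0 < L" using sdist_eq_0_iff[of y z] sdist_nonneg[of y z] unit \<open>z \<noteq> y\<close> by (auto simp: L_def)
  have Lpi: "L < pi"
    using sdist_triangle[of y p z] unit ball \<rho> pi_gt3 by (simp add: L_def sdist_commute[of y p])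
  obtain u where u: "tangent_direction y u" and zu: "geodesic y u L = z"
    by (rule geodesic_between[OF unit(6,7) L_def[symmetric] L Lpi])
  let ?\<gamma> = "geodesic y u" and ?\<gamma>' = "geodesic u (- y)"
  have n: "norm (?\<gamma> t) = 1" for t by (rule norm_geodesic[OF u])
  have near: "sdist x (?\<gamma> t) \<le> 1.279" "norm x = 1"
    if t: "0 \<le> t" "t \<le> L" and x: "x \<in> {a, b, c, d}" for t x
  proof -
    show x1: "norm x = 1" using x unit by auto
    have "sdist x y \<le> 1.279" "sdist x z \<le> 1.279"
      using \<rho> \<rho>(1)[OF x] ball sdist_triangle[of x p y] sdist_triangle[of x p z] unit x1
      by (auto simp: sdist_commute)
    then show "sdist x (?\<gamma> t) \<le> 1.279"
      using sdist_geodesic_le[OF u x1 L Lpi t, of "1.279"] zu pi_gt3 by auto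
  qed
  have hemi: "0 < ?\<gamma> t \<bullet> x" if "0 \<le> t" "t \<le> L" "x \<in> {a, b, c, d}" for t x
    using near[OF that] n by (intro inner_pos_of_sdist_le) auto
  have \<kappa>: "(1 - 1.279\<^sup>2 / 2) * sin (sdist (?\<gamma> t) x) \<le> sdist (?\<gamma> t) x * cos (sdist (?\<gamma> t) x)"
    if "0 \<le> t" "t \<le> L" "x \<in> {a, b, c, d}" for t x
    using near[OF that] n[of t] sdist_nonneg[of "?\<gamma> t" x] pi_gt3
    by (intro cot_lower_bound_coarse) (auto simp: sdist_commute)
  have \<kappa>b: "(1 - 1.279\<^sup>2 / 2) * sin (sdist (?\<gamma> t) b) \<le> sdist (?\<gamma> t) b * cos (sdist (?\<gamma> t) b)"
    and \<kappa>c: "(1 - 1.279\<^sup>2 / 2) * sin (sdist (?\<gamma> t) c) \<le> sdist (?\<gamma> t) c * cos (sdist (?\<gamma> t) c)"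
    if "0 \<le> t" "t \<le> L" for t using \<kappa>[OF that] by auto
  note along = u unit(1-4) hemi _ \<kappa>b _ \<kappa>c
  have deriv: "((\<lambda>t. ?E (?\<gamma> t)) has_real_derivative - 2 * (?F (?\<gamma> t) \<bullet> ?\<gamma>' t)) (at t)"
    if "0 \<le> t" "t \<le> L" for t by (rule scheme_energy_deriv[where L = L, OF along]) (use that in auto)
  then obtain t where t: "0 < t" "t < L" "?E (?\<gamma> L) - ?E (?\<gamma> 0) = (L - 0) * (- 2 * (?F (?\<gamma> t) \<bullet> ?\<gamma>' t))"
    using MVT2[OF L, of "\<lambda>t. ?E (?\<gamma> t)" "\<lambda>t. - 2 * (?F (?\<gamma> t) \<bullet> ?\<gamma>' t)"] by blast
  have "(21 * (1 - 1.279\<^sup>2 / 2) + 13 * (1 - 1.279\<^sup>2 / 2) - 2) / 32 * (t - 0) \<le>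
      ?F (?\<gamma> 0) \<bullet> ?\<gamma>' 0 - ?F (?\<gamma> t) \<bullet> ?\<gamma>' t"
    by (rule scheme_force_monotone[where L = L, OF along]) (use t in auto)
  then have neg: "?F (?\<gamma> t) \<bullet> ?\<gamma>' t < 0" using t(1) y by (simp add: power2_eq_square)
  have "0 < L * (- 2 * (?F (?\<gamma> t) \<bullet> ?\<gamma>' t))" by (rule mult_pos_pos[OF L]) (use neg in simp)
  then show ?thesis using t(3) zu by simp
qed

section \<open>Contraction\<close>

lemma sphere_log_diff_le:
  fixes y p q :: "'a::euclidean_space"
  assumes "norm y = 1" "norm p = 1" "norm q = 1" "sdist p y \<le> R" "sdist q y \<le> R" "R \<le> 2"
    and "1 / (1 - R\<^sup>2 / 6) \<le> \<Phi>" "sdist p q \<le> \<delta>"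
  shows "norm (sphere_log y q - sphere_log y p) \<le> \<Phi> * \<delta>"
proof -
  have R: "0 \<le> R" using sdist_nonneg[of p y] assms by simp
  have "R\<^sup>2 \<le> 2\<^sup>2" using R assms by (intro power_mono) auto
  then have "1 \<le> 1 / (1 - R\<^sup>2 / 6)" by simp
  then have \<Phi>: "1 \<le> \<Phi>" using assms by simp
  have ratio: "arc_ratio (sdist y x) \<le> \<Phi>" if "norm x = 1" "sdist x y \<le> R" for x
    using arc_ratio_upper_bound[of "sdist y x" R] that assms sdist_nonneg[of y x]
    by (simp add: sdist_commute)
  have "norm (sphere_log y q - sphere_log y p) \<le> \<Phi> * sdist q p"
    using assms ratio \<Phi> pi_gt3 by (intro sphere_log_lipschitz) (auto simp: sdist_commute)
  also have "\<dots> \<le> \<Phi> * \<delta>" using \<Phi> assms by (intro mult_left_mono) (auto simp: sdist_commute)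
  finally show ?thesis .
qed

text \<open>Consecutive new points on the same edge. The difference of the two forces involves only the
  edge itself, with weight \<open>1 / 4\<close>.\<close>

lemma contraction_same_edge:
  fixes a b c d y z :: "'a::euclidean_space"
  assumes unit: "norm a = 1" "norm b = 1" "norm c = 1" "norm d = 1" "norm y = 1" "norm z = 1"
    and \<delta>: "sdist a b \<le> \<delta>" "sdist b c \<le> \<delta>" "sdist c d \<le> \<delta>" "\<delta> \<le> 0.4"
    and y: "sdist y b \<le> 0.215" "scheme_force a b c d y = 0"
    and z: "sdist z c \<le> 0.215" "scheme_force d c b a z = 0"
  shows "sdist y z \<le> 0.99 * \<delta>"
proof -
  have \<delta>': "sdist a b \<le> 0.4" "sdist b c \<le> 0.4" "sdist c d \<le> 0.4"
    "sdist d c \<le> 0.4" "sdist c b \<le> 0.4" "sdist b a \<le> 0.4" using \<delta> by (auto simp: sdist_commute)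
  have \<delta>0: "0 \<le> \<delta>" using \<delta>(1) sdist_nonneg[of a b] unit by simp
  have yc: "sdist y c \<le> 0.335" by (rule scheme_force_zero_near_c[of a b c d]) (use unit \<delta>' y in auto)
  have zb: "sdist z b \<le> 0.335" by (rule scheme_force_zero_near_c[of d c b a]) (use unit \<delta>' z in auto)
  have yad: "sdist a y \<le> 0.615" "sdist d y \<le> 1.015"
    using data_near_ball_around_b[of a b c d y] unit \<delta>' y by auto
  have zad: "sdist d z \<le> 0.615" "sdist a z \<le> 1.015"
    using data_near_ball_around_b[of d c b a z] unit \<delta>' z by auto
  have "scheme_force d c b a y = scheme_force d c b a y - scheme_force a b c d y" using y by simp
  also have "\<dots> = (1 / 32) *\<^sub>R (8 *\<^sub>R (sphere_log y c - sphere_log y b))"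
  proof -
    have "21 *\<^sub>R C + 13 *\<^sub>R B - D - A - (21 *\<^sub>R B + 13 *\<^sub>R C - A - D) = 8 *\<^sub>R (C - B)" for A B C D :: 'a
    proof -
      have "21 *\<^sub>R X = 8 *\<^sub>R X + 13 *\<^sub>R X" for X :: 'a by (simp flip: scaleR_add_left)
      then show ?thesis by (simp add: scaleR_diff_right)
    qed
    then show ?thesis unfolding scheme_force_def scaleR_diff_right[symmetric] by simp
  qed
  finally have F: "norm (scheme_force d c b a y) = norm (sphere_log y c - sphere_log y b) / 4" by simp
  have "(32 - 7.56 * 0.335\<^sup>2 - 4.68 * 0.335\<^sup>2) / 32 * sdist y z \<le> norm (scheme_force d c b a y)"
    by (rule scheme_force_stability) (use unit y z yc zb yad zad in \<open>auto simp: sdist_commute\<close>)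
  moreover have "norm (sphere_log y c - sphere_log y b) \<le> 1.02 * \<delta>"
    by (rule sphere_log_diff_le[where R = "0.335"])
      (use unit y yc \<delta> in \<open>auto simp: sdist_commute power2_eq_square\<close>)
  ultimately show ?thesis using F \<delta>0 by (simp add: power2_eq_square)
qed

text \<open>Consecutive new points on adjacent edges. The differences of the coefficients sum up to the
  rule for the differences of linearly refined data, whose coefficients \<open>- 1, 13, 13, - 1\<close> over
  \<open>32\<close> have absolute sum \<open>7 / 8\<close>. The excess of the arc ratios over one and the defect of the
  convexity modulus are small enough for data with distances at most \<open>0.4\<close> to keep the quotient
  below one.\<close>

lemma contraction_adjacent_edges:
  fixes a b c d e y z :: "'a::euclidean_space"
  assumes unit: "norm a = 1" "norm b = 1" "norm c = 1" "norm d = 1" "norm e = 1" "norm y = 1" "norm z = 1"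
    and \<delta>: "sdist a b \<le> \<delta>" "sdist b c \<le> \<delta>" "sdist c d \<le> \<delta>" "sdist d e \<le> \<delta>" "\<delta> \<le> 0.4"
    and y: "sdist y c \<le> 0.215" "scheme_force d c b a y = 0"
    and z: "sdist z c \<le> 0.215" "scheme_force b c d e z = 0"
  shows "sdist y z \<le> 0.99 * \<delta>"
proof -
  have \<delta>': "sdist a b \<le> 0.4" "sdist b c \<le> 0.4" "sdist c d \<le> 0.4" "sdist d e \<le> 0.4"
    "sdist d c \<le> 0.4" "sdist c b \<le> 0.4" "sdist b a \<le> 0.4" using \<delta> by (auto simp: sdist_commute)
  have \<delta>0: "0 \<le> \<delta>" using \<delta>(1) sdist_nonneg[of a b] unit by simp
  have yb: "sdist b y \<le> 0.335"
    using scheme_force_zero_near_c[of d c b a y] unit \<delta>' y by (simp add: sdist_commute)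
  have zd: "sdist d z \<le> 0.335"
    using scheme_force_zero_near_c[of b c d e z] unit \<delta>' z by (simp add: sdist_commute)
  have cd: "sdist c y \<le> 0.215" "sdist c z \<le> 0.215" "sdist d y \<le> 0.615" "sdist b z \<le> 0.615"
    using data_near_ball_around_b[of d c b a y] data_near_ball_around_b[of b c d e z] unit \<delta>' y z by auto
  have ae: "sdist a y \<le> 0.735" "sdist e y \<le> 1.015" "sdist e z \<le> 0.735"
    using sdist_triangle[of a b y] sdist_triangle[of e d y] sdist_triangle[of e d z] unit \<delta>' yb zd cd
    by (auto simp: sdist_commute)
  have ab: "norm (sphere_log y b - sphere_log y a) \<le> 1.099 * \<delta>"
    by (rule sphere_log_diff_le[where R = "0.735"]) (use unit \<delta> yb ae in \<open>auto simp: power2_eq_square\<close>)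
  have bc: "norm (sphere_log y c - sphere_log y b) \<le> 1.0191 * \<delta>"
    by (rule sphere_log_diff_le[where R = "0.335"]) (use unit \<delta> yb cd in \<open>auto simp: power2_eq_square\<close>)
  have cd': "norm (sphere_log y d - sphere_log y c) \<le> 1.0673 * \<delta>"
    by (rule sphere_log_diff_le[where R = "0.615"]) (use unit \<delta> cd in \<open>auto simp: power2_eq_square\<close>)
  have de: "norm (sphere_log y e - sphere_log y d) \<le> 1.2074 * \<delta>"
    by (rule sphere_log_diff_le[where R = "1.015"]) (use unit \<delta> cd ae in \<open>auto simp: power2_eq_square\<close>)
  let ?u = "sphere_log y b - sphere_log y a" and ?v = "sphere_log y c - sphere_log y b"
    and ?w = "sphere_log y d - sphere_log y c" and ?x = "sphere_log y e - sphere_log y d"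
  have "scheme_force b c d e y = scheme_force b c d e y - scheme_force d c b a y" using y by simp
  also have "\<dots> = (1 / 32) *\<^sub>R (13 *\<^sub>R ?v + 13 *\<^sub>R ?w - ?u - ?x)"
  proof -
    have "21 *\<^sub>R C + 13 *\<^sub>R D - B - E - (21 *\<^sub>R C + 13 *\<^sub>R B - D - A)
        = 13 *\<^sub>R (C - B) + 13 *\<^sub>R (D - C) - (B - A) - (E - D)" for A B C D E :: 'a
      by (simp add: algebra_simps)
    then show ?thesis unfolding scheme_force_def scaleR_diff_right[symmetric] by simp
  qed
  also have "norm \<dots> \<le> (13 * norm ?v + 13 * norm ?w + norm ?u + norm ?x) / 32"
  proof -
    have "norm (13 *\<^sub>R ?v + 13 *\<^sub>R ?w - ?u - ?x) \<le> norm (13 *\<^sub>R ?v) + norm (13 *\<^sub>R ?w) + norm ?u + norm ?x"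
      by (meson norm_add_leD norm_triangle_ineq norm_triangle_ineq4 order_trans add_mono order_refl)
    then show ?thesis by simp
  qed
  also have "\<dots> \<le> 0.9197 * \<delta>" using ab bc cd' de \<delta>0 by simp
  finally have F: "norm (scheme_force b c d e y) \<le> 0.9197 * \<delta>" .
  have "(32 - 7.56 * 0.215\<^sup>2 - 4.68 * 0.615\<^sup>2) / 32 * sdist y z \<le> norm (scheme_force b c d e y)"
    by (rule scheme_force_stability) (use unit y z yb zd cd ae in auto)
  then have "0.9337 * sdist y z \<le> 0.9197 * \<delta>"
    using F sdist_nonneg[of y z] unit by (simp add: power2_eq_square)
  then show ?thesis using \<delta>0 by simp
qed

section \<open>The refinement step\<close>

lemma negative_mass_scheme: "negative_mass scheme_mask i = 1 / 16"
proof (cases "even i")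
  case True
  then obtain k where i: "i = 2 * k" by (elim evenE)
  have "{j. scheme_mask (i - 2 * j) < 0} = {k - 1, k + 2}"
    unfolding i by (auto simp: scheme_mask_def split: if_splits; presburger)
  then show ?thesis unfolding negative_mass_def i by (simp add: scheme_mask_def)
next
  case False
  then obtain k where i: "i = 2 * k + 1" by (elim oddE)
  have "{j. scheme_mask (i - 2 * j) < 0} = {k - 1, k + 2}"
    unfolding i by (auto simp: scheme_mask_def split: if_splits; presburger)
  then show ?thesis unfolding negative_mass_def i by (simp add: scheme_mask_def)
qed

lemma squared_dist_sum_scheme:
  "squared_dist_sum scheme_mask x (2 * i) y = scheme_energy (x (i - 1)) (x i) (x (i + 1)) (x (i + 2)) y"
  "squared_dist_sum scheme_mask x (2 * i + 1) y = scheme_energy (x (i + 2)) (x (i + 1)) (x i) (x (i - 1)) y"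
  unfolding squared_dist_sum_def stencil_scheme scheme_energy_def
  by (simp_all add: scheme_mask_def field_simps)

lemma spherical_midpoint:
  fixes b c :: "'a::euclidean_space"
  assumes "norm b = 1" "norm c = 1" "sdist b c < pi"
  obtains m where "norm m = 1" "sdist m b = sdist b c / 2" "sdist m c = sdist b c / 2"
proof (cases "sdist b c = 0")
  case True
  then show thesis using that[of b] assms sdist_eq_0_iff[of b c] by simp
next
  case False
  define L where "L = sdist b c"
  have L: "0 < L" "L < pi" using False assms sdist_nonneg[of b c] by (auto simp: L_def)
  obtain u where u: "tangent_direction b u" and c: "geodesic b u L = c"
    by (rule geodesic_between[OF assms(1,2) L_def[symmetric] L])
  let ?m = "geodesic b u (L / 2)"
  have "?m \<bullet> c = cos (L / 2) * cos L + sin (L / 2) * sin L"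
    using u unfolding c[symmetric] geodesic_def tangent_direction_def norm_eq_1
    by (simp add: inner_add inner_commute)
  then have "?m \<bullet> c = cos (L / 2)" using cos_diff[of L "L / 2"] by (simp add: mult.commute)
  then have "sdist ?m c = L / 2" using L by (intro sdist_eqI) auto
  moreover have "sdist ?m b = L / 2" using sdist_start_geodesic[OF u, of "L / 2"] L by (simp add: sdist_commute)
  ultimately show thesis using that[of ?m] norm_geodesic[OF u] by (simp add: L_def)
qed

text \<open>An admissible pair of balls exists because the four data points lie in a ball of radius less
  than \<open>0.6\<close> around the midpoint of the central edge: \<open>0.6\<close> and \<open>0.676\<close> satisfy the
  inequalities that the radii are subject to, since \<open>8 pi / (34 + pi)\<close> is slightly larger than
  \<open>0.676\<close>. This is where the bound \<open>0.4\<close> comes from.\<close>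

lemma scheme_force_zero_is_value:
  fixes x :: "int \<Rightarrow> 'a::euclidean_space"
  assumes energy: "\<And>z. squared_dist_sum scheme_mask x i z = scheme_energy a b c d z"
    and stencil: "x ` stencil scheme_mask i = {a, b, c, d}"
    and unit: "norm a = 1" "norm b = 1" "norm c = 1" "norm d = 1" "norm y = 1"
    and \<delta>: "sdist a b \<le> \<delta>" "sdist b c \<le> \<delta>" "sdist c d \<le> \<delta>" "\<delta> < 0.4"
    and y: "sdist y b \<le> 0.215" "scheme_force a b c d y = 0"
  shows "is_riemannian_value scheme_mask x i y"
proof -
  have adm: "admissible_balls scheme_mask x i p \<rho> \<rho>' \<longleftrightarrow>
      norm p = 1 \<and> (\<forall>z\<in>{a, b, c, d}. sdist p z < \<rho>) \<and> \<rho> < \<rho>' \<and> 9 / 8 * \<rho> < \<rho>'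
      \<and> \<rho>' < 8 * pi / (34 + pi)" for p \<rho> \<rho>'
  proof -
    have radius: "pi / 4 * inverse (1 + (1 + pi / 2) * (1 / 16)) = 8 * pi / (34 + pi)"
      using pi_gt_zero by (simp add: divide_simps)
    have points: "(\<forall>j\<in>stencil scheme_mask i. x j \<in> sball \<rho> p) \<longleftrightarrow> (\<forall>z\<in>{a, b, c, d}. sdist p z < \<rho>)"
    proof -
      have "x j \<in> {a, b, c, d}" if "j \<in> stencil scheme_mask i" for j using stencil that by blast
      then have "\<forall>j\<in>stencil scheme_mask i. norm (x j) = 1" using unit by blast
      then show ?thesis unfolding stencil[symmetric] by (auto simp: sball_def)
    qed
    have "1 + 2 * (1 / 16) = (9 / 8 :: real)" by simp
    then show ?thesis
      by (simp only: admissible_balls_def negative_mass_scheme radius points mem_sphere_0)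
  qed
  have "\<exists>p \<rho> \<rho>'. admissible_balls scheme_mask x i p \<rho> \<rho>'"
  proof -
    obtain m where m: "norm m = 1" "sdist m b = sdist b c / 2" "sdist m c = sdist b c / 2"
      using spherical_midpoint[of b c] unit \<delta> pi_gt3 by auto
    have "sdist m b < 0.2" "sdist m c < 0.2" using m \<delta> by auto
    moreover have "sdist m a < 0.6" "sdist m d < 0.6"
      using sdist_triangle[of m b a] sdist_triangle[of m c d] unit m \<delta> by (auto simp: sdist_commute)
    moreover have "0.676 < 8 * pi / (34 + pi)" using pi_approx by (simp add: pos_less_divide_eq)
    ultimately have "admissible_balls scheme_mask x i m 0.6 0.676" unfolding adm using m(1) by auto
    then show ?thesis by blast
  qed
  moreover have "unique_minimiser_on (squared_dist_sum scheme_mask x i) (sball \<rho>' p) y"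
    if "admissible_balls scheme_mask x i p \<rho> \<rho>'" for p \<rho> \<rho>'
  proof -
    have p: "norm p = 1" and near: "\<And>z. z \<in> {a, b, c, d} \<Longrightarrow> sdist p z < \<rho>" and \<rho>: "9 / 8 * \<rho> < \<rho>'"
      and "\<rho>' < 8 * pi / (34 + pi)" using that unfolding adm by auto
    moreover have "8 * pi / (34 + pi) < 0.677" using pi_approx by (simp add: pos_divide_less_eq)
    ultimately have \<rho>': "\<rho>' < 0.677" by simp
    have py: "sdist p y < \<rho>'" by (rule scheme_force_zero_in_ball[OF unit(1-4) p unit(5) near \<rho> \<rho>' y])
    have "scheme_energy a b c d y < scheme_energy a b c d z"
      if "z \<in> sball \<rho>' p" "z \<noteq> y" for z
      using that by (intro scheme_force_zero_minimises[OF unit(1-4) p unit(5) _ near \<rho> \<rho>' y(2) py])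
        (auto simp: sball_def)
    then show ?thesis unfolding unique_minimiser_on_def energy using py unit by (auto simp: sball_def)
  qed
  ultimately show ?thesis unfolding is_riemannian_value_def by blast
qed

definition spherical_data :: "real \<Rightarrow> (int \<Rightarrow> 'a::euclidean_space) \<Rightarrow> bool" where
  "spherical_data \<delta> x \<longleftrightarrow> (\<forall>l. norm (x l) = 1) \<and> (\<forall>l. sdist (x l) (x (l + 1)) \<le> \<delta>)"

lemma riemannian_step:
  fixes x :: "int \<Rightarrow> 'a::euclidean_space"
  assumes "spherical_data \<delta> x" "\<delta> < 0.4"
  defines "T \<equiv> riemannian_analogue scheme_mask x"
  shows step_defined: "riemannian_analogue_defined scheme_mask x"
    and step_contracts: "spherical_data (0.99 * \<delta>) T"
    and step_displacement: "sdist (T (2 * i)) (x i) \<le> \<delta>"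
proof -
  have unit: "norm (x l) = 1" and \<delta>: "sdist (x l) (x (l + 1)) \<le> \<delta>" for l
    using assms by (auto simp: spherical_data_def)
  have edges: "sdist (x (i - 1)) (x i) \<le> \<delta>" "sdist (x i) (x (i + 1)) \<le> \<delta>"
    "sdist (x (i + 1)) (x (i + 2)) \<le> \<delta>" "sdist (x (i + 2)) (x (i + 3)) \<le> \<delta>" for i
    using \<delta>[of "i - 1"] \<delta>[of i] \<delta>[of "i + 1"] \<delta>[of "i + 2"] by (simp_all add: algebra_simps)
  have edges4: "sdist (x (i - 1)) (x i) \<le> 0.4" "sdist (x i) (x (i + 1)) \<le> 0.4"
    "sdist (x (i + 1)) (x (i + 2)) \<le> 0.4" for i
    using edges[of i] assms(2) by linarith+
  have "\<exists>y. norm y = 1 \<and> sdist y (x i) \<le> 0.215 \<and>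
      scheme_force (x (i - 1)) (x i) (x (i + 1)) (x (i + 2)) y = 0" for i
    using scheme_force_zero_exists[OF unit unit unit unit edges4] by blast
  then obtain E where E: "\<And>i. norm (E i) = 1" "\<And>i. sdist (E i) (x i) \<le> 0.215"
      "\<And>i. scheme_force (x (i - 1)) (x i) (x (i + 1)) (x (i + 2)) (E i) = 0" by metis
  \<comment> \<open>The odd rule reads the four data points in reverse order.\<close>
  have "\<exists>y. norm y = 1 \<and> sdist y (x (i + 1)) \<le> 0.215 \<and>
      scheme_force (x (i + 2)) (x (i + 1)) (x i) (x (i - 1)) y = 0" for i
    by (rule scheme_force_zero_exists[of "x (i + 2)" "x (i + 1)" "x i" "x (i - 1)"])
      (use edges4[of i] unit in \<open>auto simp: sdist_commute\<close>)
  then obtain O' where O: "\<And>i. norm (O' i) = 1" "\<And>i. sdist (O' i) (x (i + 1)) \<le> 0.215"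
      "\<And>i. scheme_force (x (i + 2)) (x (i + 1)) (x i) (x (i - 1)) (O' i) = 0" by metis
  have valE: "is_riemannian_value scheme_mask x (2 * i) (E i)" for i
    by (rule scheme_force_zero_is_value[OF squared_dist_sum_scheme(1) _ unit unit unit unit E(1) edges(1-3)])
      (use assms(2) E in \<open>auto simp: stencil_scheme\<close>)
  have valO: "is_riemannian_value scheme_mask x (2 * i + 1) (O' i)" for i
    by (rule scheme_force_zero_is_value[where \<delta> = \<delta>, OF squared_dist_sum_scheme(2) _ unit unit unit unit O(1)])
      (use assms(2) O edges[of i] in \<open>auto simp: stencil_scheme sdist_commute\<close>)
  have T: "T (2 * i) = E i" "T (2 * i + 1) = O' i" for i
    unfolding T_def riemannian_analogue_def using valE valO is_riemannian_value_unique by blast+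
  show "riemannian_analogue_defined scheme_mask x"
    unfolding riemannian_analogue_defined_def using valE valO by (metis evenE oddE)
  show "sdist (T (2 * i)) (x i) \<le> \<delta>"
    unfolding T
    by (rule scheme_force_zero_displacement[OF unit unit unit unit E(1) edges(1-3)]) (use assms(2) E in auto)
  have "norm (T l) = 1 \<and> sdist (T l) (T (l + 1)) \<le> 0.99 * \<delta>" for l
  proof (cases "even l")
    case True
    then obtain i where l: "l = 2 * i" by (elim evenE)
    have "sdist (E i) (O' i) \<le> 0.99 * \<delta>"
      by (rule contraction_same_edge[OF unit unit unit unit E(1) O(1) edges(1-3)]) (use assms(2) E O in auto)
    then show ?thesis unfolding l T using E by simp
  next
    case False
    then obtain i where l: "l = 2 * i + 1" by (elim oddE)
    have "sdist (O' i) (E (i + 1)) \<le> 0.99 * \<delta>"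
      by (rule contraction_adjacent_edges[OF unit unit unit unit unit O(1) E(1) edges])
        (use assms(2) E(2,3)[of "i + 1"] O[of i] in \<open>auto simp: algebra_simps\<close>)
    moreover have "l + 1 = 2 * (i + 1)" using l by simp
    ultimately show ?thesis unfolding \<open>l + 1 = 2 * (i + 1)\<close> unfolding l T using O by simp
  qed
  then show "spherical_data (0.99 * \<delta>) T" by (simp add: spherical_data_def)
qed

section \<open>Convergence\<close>

lemma chart_interpolation_bounds:
  fixes y :: "int \<Rightarrow> 'a::euclidean_space"
  assumes "spherical_data \<delta> y" "\<delta> < pi"
  shows "norm (chart_interpolation k y t) = 1"
    and "norm (chart_interpolation k y t - y \<lfloor>2 ^ k * t\<rfloor>) \<le> \<delta>"
proof -
  define i where "i = \<lfloor>2 ^ k * t\<rfloor>"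
  define s where "s = 2 ^ k * t - of_int i"
  define p q where "p = y i" and "q = y (i + 1)"
  have p: "norm p = 1" and q: "norm q = 1" and pq: "sdist p q \<le> \<delta>"
    using assms by (auto simp: spherical_data_def p_def q_def)
  have s: "0 \<le> s" "s \<le> 1" unfolding s_def i_def by linarith+
  define v where "v = normal_coords p q"
  have anti: "q \<noteq> - p"
  proof
    assume "q = - p"
    then have "sdist p q = pi" using p by (simp add: sdist_def norm_eq_1)
    then show False using pq assms by simp
  qed
  have p0: "p \<in> sphere 0 1" "q \<in> sphere 0 1" using p q by auto
  have log: "sphere_log p q \<in> {v. p \<bullet> v = 0 \<and> norm v < pi}" "sphere_exp p (sphere_log p q) = q"
  proof -
    have n: "norm (sphere_log p q) = sdist p q" using norm_sphere_log p q pq assms by force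
    then show "sphere_log p q \<in> {v. p \<bullet> v = 0 \<and> norm v < pi}"
      using sphere_log_orthogonal[OF p] pq assms by simp
    have "sin (sdist p q) / sdist p q * arc_ratio (sdist p q) = 1" if "p \<noteq> q"
      using arc_ratio_mult_sin[of "sdist p q"] sdist_eq_0_iff[OF p q] that sdist_nonneg[OF p q] pq assms
      by (simp add: mult.commute)
    then show "sphere_exp p (sphere_log p q) = q"
      unfolding sphere_exp_def n using cos_sdist[OF p q] p
      by (cases "p = q") (auto simp: sphere_log_self sdist_self sphere_log_def[of p q] norm_eq_1)
  qed
  have v: "v = sphere_log p q"
    using normal_coords_exp[OF p0(1), of "sphere_log p q"] log by (simp add: v_def)
  have nv: "norm v \<le> \<delta>" using norm_sphere_log[OF p q] pq assms v by simp
  have "normal_coords p p = 0"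
    using normal_coords_exp[OF p0(1), of 0] by (simp add: sphere_exp_def)
  then have chart: "chart_interpolation k y t = sphere_exp p (s *\<^sub>R v)"
    by (simp add: chart_interpolation_def Let_def s_def p_def q_def v_def flip: i_def)
  define w where "w = s *\<^sub>R v"
  have w: "p \<bullet> w = 0" using log(1) by (simp add: w_def v)
  have nw: "norm w \<le> \<delta>"
    using mult_mono[OF s(2) nv] s by (simp add: w_def)
  have pw: "p \<bullet> sphere_exp p w = cos (norm w)"
    using p w by (simp add: sphere_exp_def inner_add_right norm_eq_1)
  have "sphere_exp p w \<bullet> sphere_exp p w = (cos (norm w))\<^sup>2 + (sin (norm w) / norm w)\<^sup>2 * (w \<bullet> w)"
    using p w by (simp add: sphere_exp_def inner_add inner_commute norm_eq_1 power2_eq_square)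
  also have "\<dots> = (cos (norm w))\<^sup>2 + (sin (norm w))\<^sup>2"
    by (cases "w = 0") (simp_all add: power_divide flip: power2_norm_eq_inner)
  finally have one: "norm (sphere_exp p w) = 1" by (simp add: norm_eq_1)
  then show "norm (chart_interpolation k y t) = 1" by (simp add: chart w_def)
  have "sdist p (sphere_exp p w) = norm w" using pw nw assms by (intro sdist_eqI) auto
  then have "norm (sphere_exp p w - p) \<le> \<delta>"
    using norm_diff_le_sdist[OF p one] nw by (simp add: norm_minus_commute)
  then show "norm (chart_interpolation k y t - y \<lfloor>2 ^ k * t\<rfloor>) \<le> \<delta>"
    by (simp add: chart w_def p_def i_def)
qed

text \<open>Contraction with a fixed factor, for all iterates, makes the interpolating functions a
  uniform Cauchy sequence. The limit is continuous because on an interval shorter than the spacing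
  of the parameters the interpolating functions vary by no more than a multiple of the largest
  distance between neighbouring data points, which tends to zero.\<close>

theorem scheme_converges:
  fixes x :: "int \<Rightarrow> 'a::euclidean_space"
  assumes x: "spherical_data \<delta> x" and \<delta>: "\<delta> < 0.4"
  shows "riemannian_converges scheme_mask x"
proof -
  define X where "X = (\<lambda>k. (riemannian_analogue scheme_mask ^^ k) x)"
  define f where "f = (\<lambda>k. chart_interpolation k (X k))"
  define m where "m = (\<lambda>k. \<delta> * 0.99 ^ k)"
  have \<delta>0: "0 \<le> \<delta>" using x sdist_nonneg[of "x 0" "x 1"] by (auto simp: spherical_data_def dest!: spec[of _ 0])
  have XS: "X (Suc k) = riemannian_analogue scheme_mask (X k)" for k by (simp add: X_def)
  have m_le: "m k < 0.4" "m (Suc k) \<le> m k" "m k < pi" for k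
  proof -
    have "\<delta> * 0.99 ^ k \<le> \<delta> * 1" using \<delta>0 by (intro mult_left_mono power_le_one) auto
    then show "m k < 0.4" "m k < pi" using \<delta> pi_gt3 by (auto simp: m_def)
    show "m (Suc k) \<le> m k" using \<delta>0 by (simp add: m_def mult_left_mono)
  qed
  have data: "spherical_data (m k) (X k)" for k
  proof (induction k)
    case 0
    then show ?case using x by (simp add: m_def X_def)
  next
    case (Suc k)
    then show ?case using step_contracts[OF Suc m_le(1)] by (simp add: XS m_def mult.left_commute)
  qed
  have unit: "norm (X k l) = 1" and edge: "norm (X k l - X k (l + 1)) \<le> m k" for k l
    using data[of k] norm_diff_le_sdist[of "X k l" "X k (l + 1)"]
    by (auto simp: spherical_data_def intro: order_trans)
  have disp: "norm (X (Suc k) (2 * i) - X k i) \<le> m k" for k i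
    using norm_diff_le_sdist[OF unit[of "Suc k" "2 * i"] unit[of k i]] step_displacement[OF data m_le(1), of k i]
    by (simp add: XS)
  have f1: "norm (f k t) = 1" and near: "norm (f k t - X k \<lfloor>2 ^ k * t\<rfloor>) \<le> m k" for k t
    unfolding f_def using chart_interpolation_bounds[OF data m_le(3)] by auto
  have step: "norm (f (Suc k) t - f k t) \<le> 4 * m k" for k t
  proof -
    define i j where "i = \<lfloor>2 ^ k * t\<rfloor>" and "j = \<lfloor>2 ^ Suc k * t\<rfloor>"
    have "j = 2 * i \<or> j = 2 * i + 1"
    proof -
      have "j = \<lfloor>2 * (2 ^ k * t)\<rfloor>" by (simp add: j_def mult.assoc)
      then show ?thesis unfolding i_def by linarith
    qed
    then have "norm (X (Suc k) j - X (Suc k) (2 * i)) \<le> m k"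
      using edge[of "Suc k" "2 * i"] m_le(2)[of k] norm_ge_zero[of "X (Suc k) (2 * i) - X (Suc k) (2 * i + 1)"]
      by (auto simp: norm_minus_commute simp del: norm_ge_zero)
    moreover have "norm (f (Suc k) t - X (Suc k) j) \<le> m k"
      using near[of "Suc k" t] m_le(2)[of k] by (simp add: j_def)
    moreover have "norm (X k i - f k t) \<le> m k"
      using near[of k t] by (simp add: i_def norm_minus_commute)
    moreover have "f (Suc k) t - f k t = (f (Suc k) t - X (Suc k) j) + (X (Suc k) j - X (Suc k) (2 * i))
        + (X (Suc k) (2 * i) - X k i) + (X k i - f k t)" by simp
    ultimately show ?thesis
      using disp[of k i] norm_triangle_le[of _ _ "3 * m k + m k"]
      by (smt (verit) norm_triangle_ineq)
  qed
  have sum: "summable (\<lambda>k. 4 * m k)"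
    unfolding m_def by (intro summable_mult summable_geometric) simp
  have "uniform_limit UNIV (\<lambda>n t. \<Sum>k<n. f (Suc k) t - f k t) (\<lambda>t. \<Sum>k. f (Suc k) t - f k t) sequentially"
    by (rule Weierstrass_m_test[OF step sum])
  then have "uniform_limit UNIV (\<lambda>n t. f 0 t + (\<Sum>k<n. f (Suc k) t - f k t))
      (\<lambda>t. f 0 t + (\<Sum>k. f (Suc k) t - f k t)) sequentially"
    by (intro uniform_limit_add uniform_limit_const)
  moreover have "f 0 t + (\<Sum>k<n. f (Suc k) t - f k t) = f n t" for n t
    using sum_lessThan_telescope[of "\<lambda>k. f k t" n] by simp
  ultimately obtain g where g: "uniform_limit UNIV f g sequentially" by (simp only:)
  have m0: "m \<longlonglongrightarrow> 0"
    unfolding m_def by (intro tendsto_mult_right_zero LIMSEQ_power_zero) simp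
  have vary: "norm (f k s - f k t) \<le> 3 * m k" if "dist s t < 1 / 2 ^ k" for k s t
  proof -
    define i j where "i = \<lfloor>2 ^ k * s\<rfloor>" and "j = \<lfloor>2 ^ k * t\<rfloor>"
    have "\<bar>2 ^ k * s - 2 ^ k * t\<bar> = 2 ^ k * dist s t"
      by (simp add: dist_real_def abs_mult flip: right_diff_distrib)
    also have "\<dots> < 1" using that by (simp add: pos_less_divide_eq mult.commute)
    finally have "i = j \<or> i = j + 1 \<or> j = i + 1" unfolding i_def j_def by linarith
    then have "norm (X k i - X k j) \<le> m k"
      using edge[of k i] edge[of k j] norm_ge_zero[of "X k i - X k (i + 1)"]
      by (auto simp: norm_minus_commute simp del: norm_ge_zero)
    moreover have "norm (f k s - X k i) \<le> m k" "norm (X k j - f k t) \<le> m k"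
      using near[of k s] near[of k t] by (simp_all add: i_def j_def norm_minus_commute)
    moreover have "f k s - f k t = (f k s - X k i) + (X k i - X k j) + (X k j - f k t)" by simp
    ultimately show ?thesis by (smt (verit) norm_triangle_ineq)
  qed
  have "continuous_on UNIV g"
    unfolding continuous_on_iff
  proof (intro ballI allI impI)
    fix t e :: real assume "e > 0"
    then have "\<forall>\<^sub>F k in sequentially. (\<forall>s\<in>UNIV. dist (f k s) (g s) < e / 3) \<and> m k < e / 9"
      using uniform_limitD[OF g, of "e / 3"] order_tendstoD(2)[OF m0, of "e / 9"] by (simp add: eventually_conj)
    then obtain k where k: "\<And>s. dist (f k s) (g s) < e / 3" "m k < e / 9"
      by (auto dest!: eventually_happens)
    have "dist (g s) (g t) < e" if "dist s t < 1 / 2 ^ k" for s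
    proof -
      have "dist (f k s) (f k t) < e / 3" using vary[OF that] k(2) by (simp add: dist_norm)
      then show ?thesis
        using k(1)[of s] k(1)[of t] by (metis dist_commute dist_triangle_third)
    qed
    then show "\<exists>d>0. \<forall>s\<in>UNIV. dist s t < d \<longrightarrow> dist (g s) (g t) < e"
      by (intro exI[of _ "1 / 2 ^ k"]) auto
  qed
  moreover have "g t \<in> sphere 0 1" for t
  proof (rule closed_sequentially[OF closed_sphere])
    show "(\<lambda>k. f k t) \<longlonglongrightarrow> g t" using tendsto_uniform_limitI[OF g] by simp
  qed (simp add: f1)
  moreover have "uniform_limit C f g sequentially" for C
    using g by (rule uniform_limit_on_subset) simp
  moreover have "riemannian_analogue_defined scheme_mask (X k)" for k
    by (rule step_defined[OF data m_le(1)])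
  ultimately show ?thesis unfolding riemannian_converges_def f_def X_def by blast
qed

theorem corollary13:
  fixes n :: nat and x :: "int \<Rightarrow> real ^ 'd"
  assumes "n \<ge> 2" and "CARD('d) = n + 1"
    and "\<And>l. x l \<in> sphere 0 1"
    and "(SUP l. sdist (x l) (x (l + 1))) < 0.4"
  shows "riemannian_converges scheme_mask x"
proof (rule scheme_converges[OF _ assms(4)])
  have unit: "norm (x l) = 1" for l using assms(3)[of l] by simp
  have "bdd_above (range (\<lambda>l. sdist (x l) (x (l + 1))))"
    using sdist_le_pi[OF unit unit] by (intro bdd_aboveI[of _ pi]) auto
  then show "spherical_data (SUP l. sdist (x l) (x (l + 1))) x"
    unfolding spherical_data_def using unit by (auto intro: cSUP_upper)
qed

end
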